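(* Let $\{\mathbf{C}(N)\}_{N\ge 0}$ be the Half-Plane Half-Comb (HPHC) random walk on $\mathbb{Z}^2$ started at $(0,0)$, with local time $\Xi$. Then $$\limsup_{N\to\infty}\frac{\Xi((0,0),N)}{\log N\,\log\log\log N}=\frac{2}{\pi}\qquad\text{a.s.}$$
   Context: The HPHC random walk $\mathbf{C}(N)=(C_1(N),C_2(N))$, $N=0,1,2,\ldots$, is the time-homogeneous Markov chain on $\mathbb{Z}^2$ with one-step transition probabilities $$\mathbf{P}(\mathbf{C}(N+1)=(k\pm1,j)\mid \mathbf{C}(N)=(k,j))=\tfrac12-p_j \quad\text{(for each choice of sign)},$$ $$\mathbf{P}(\mathbf{C}(N+1)=(k,j\pm1)\mid \mathbf{C}(N)=(k,j))=p_j \quad\text{(for each choice of sign)},$$ where $p_j=\tfrac14$ for $j\ge 0$ and $p_j=\tfrac12$ for $j<0$. Its local time is $\Xi((k,j),N)=\sum_{r=0}^{N} I\{\mathbf{C}(r)=(k,j)\}$ for $(k,j)\in\mathbb{Z}^2$, where $I\{\cdot\}$ is the indicator. $\log$ is the natural logarithm. *)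

theory Defs
  imports "HOL-Probability.Probability"
begin

text \<open>
  A time-homogeneous Markov chain on a countable state space (with discrete \<sigma>-algebra),
  given by its matrix of one-step transition probabilities.  The Markov property is conditioned on
  the full past \<open>X 0 = x 0, \<dots>, X N = x N\<close>, whenever that past has positive probability.
\<close>

definition markov_chain ::
  "'w measure \<Rightarrow> ('s::countable \<Rightarrow> 's \<Rightarrow> real) \<Rightarrow> (nat \<Rightarrow> 'w \<Rightarrow> 's) \<Rightarrow> bool" where
  "markov_chain M p X \<longleftrightarrow>
     prob_space M \<and>
     (\<forall>N. X N \<in> measurable M (count_space UNIV)) \<and>
     (\<forall>N (x :: nat \<Rightarrow> 's) y.
        \<P>(w in M. \<forall>i\<le>N. X i w = x i) > 0 \<longrightarrow>
        \<P>(w in M. X (Suc N) w = y \<bar> \<forall>i\<le>N. X i w = x i) = p (x N) y)"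

definition hphc_p :: "int \<Rightarrow> real" where
  "hphc_p j = (if j \<ge> 0 then 1/4 else 1/2)"

fun hphc_trans :: "int \<times> int \<Rightarrow> int \<times> int \<Rightarrow> real" where
  "hphc_trans (k, j) (k', j') =
     (if j' = j \<and> (k' = k + 1 \<or> k' = k - 1) then 1/2 - hphc_p j
      else if k' = k \<and> (j' = j + 1 \<or> j' = j - 1) then hphc_p j
      else 0)"

definition hphc_walk :: "'w measure \<Rightarrow> (nat \<Rightarrow> 'w \<Rightarrow> int \<times> int) \<Rightarrow> bool" where
  "hphc_walk M C \<longleftrightarrow> markov_chain M hphc_trans C \<and> (AE w in M. C 0 w = (0, 0))"

definition local_time :: "(nat \<Rightarrow> 'w \<Rightarrow> 's) \<Rightarrow> 's \<Rightarrow> nat \<Rightarrow> 'w \<Rightarrow> nat" where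
  "local_time X x N w = (\<Sum>r\<le>N. of_bool (X r w = x))"

end

theory Submission
  imports Defs "HOL-Real_Asymp.Real_Asymp"
begin

text \<open>
  The waiting times between successive visits to the origin are independent and identically
  distributed, and their generating function \<open>F\<close> is tied to the Green function
  \<open>U(s) = \<Sum>\<^sub>n s\<^sup>n P(C\<^sub>n = 0)\<close> by \<open>U(1 - F) = 1\<close>.  A Fourier transform in the horizontal
  coordinate turns \<open>U\<close> into an explicit integral over \<open>[0, \<pi>]\<close>, because in the vertical
  coordinate one is left with two constant-coefficient recurrences (upper and lower half plane)
  whose bounded solutions are geometric.  The integrand behaves like \<open>4 / (t + \<surd>(1 - s))\<close>, so that
  \<open>U(s) \<sim> (2/\<pi>) ln (1/(1 - s))\<close> as \<open>s \<rightarrow> 1\<close>.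

  Only the Laplace transform \<open>\<phi>\<close> of the waiting times, with
  \<open>1 - \<phi>(1/x) \<sim> \<pi> / (2 ln x)\<close>, enters the law of the iterated logarithm.  An
  exponential Chebyshev inequality along times \<open>exp (r\<^sup>k)\<close> gives the upper bound.  For the lower
  bound, the sum of many waiting times is small as soon as each of them is; this
  is applied to disjoint blocks of waiting times and times growing so fast that the contribution of
  all earlier blocks is negligible.
\<close>

section \<open>Return times of a Markov chain\<close>

text \<open>The triple logarithm comes out of \<open>less_local_time_iff\<close>: the local time at
  time N exceeds m iff m waiting times add up to at most N. This has probability roughly exp (- m /
  (\<kappa> ln N)), since each summand exceeds N with probability about 1 / (\<kappa> ln N). At N =
  exp (r ^ k) and m = c \<kappa> (ln N) (ln ln ln N) this is (k ln r) powr (- c), and c = 1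
  separates convergence from divergence. Crude Chebyshev bounds lose nothing in c, because changing
  N by a power of ln N changes ln N only by a factor tending to 1. The constant 2/pi is 4/pi times
  1/2: 1/pi normalises Fourier inversion on [0, pi], and the integral of 1 / (t + sqrt (1 - s))
  grows like ln (1 / sqrt (1 - s)), half of ln (1 / (1 - s)). Recurrence is a by-product: divergence
  of U forces F to have total mass 1. The chain is given only by conditional probabilities on finite
  histories, so independence of the waiting times is obtained by computing the probability of each
  finite pattern of return times.\<close>

primrec chain_prob :: "('s \<Rightarrow> 's \<Rightarrow> real) \<Rightarrow> ('s \<Rightarrow> 's set) \<Rightarrow> 's \<Rightarrow> nat \<Rightarrow> 's \<Rightarrow> real" where
  "chain_prob p nb a 0 x = of_bool (x = a)"
| "chain_prob p nb a (Suc n) x = (\<Sum>y\<in>nb x. p x y * chain_prob p nb a n y)"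

text \<open>A visit at time 0 counts, so from \<open>a\<close> the hitting time is 0. A genuine
  return is a step away from \<open>a\<close> followed by a hit, which is the separate
  \<open>gap_prob\<close>.\<close>

primrec hit_prob :: "('s \<Rightarrow> 's \<Rightarrow> real) \<Rightarrow> ('s \<Rightarrow> 's set) \<Rightarrow> 's \<Rightarrow> nat \<Rightarrow> 's \<Rightarrow> real" where
  "hit_prob p nb a 0 x = of_bool (x = a)"
| "hit_prob p nb a (Suc n) x = (if x = a then 0 else \<Sum>y\<in>nb x. p x y * hit_prob p nb a n y)"

lemma emeasure_countable_partition:
  fixes h :: "'w \<Rightarrow> 'c::countable"
  assumes [measurable]: "h \<in> measurable M (count_space UNIV)" "Measurable.pred M Q"
  shows "emeasure M {w\<in>space M. h w \<in> S \<and> Q w} = (\<integral>\<^sup>+ l. emeasure M {w\<in>space M. h w = l \<and> Q w} \<partial>count_space S)"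
proof -
  have "{w\<in>space M. h w \<in> S \<and> Q w} = (\<Union>l\<in>S. {w\<in>space M. h w = l \<and> Q w})" by auto
  then show ?thesis
    by (simp only:) (intro emeasure_UN_countable, auto simp: disjoint_family_on_def)
qed

text \<open>Such a set is the initial segment \<open>{..<card S}\<close>. This turns a count of
  arrivals into a condition on a single arrival.\<close>

lemma less_card_down_closed_iff:
  fixes S :: "nat set"
  assumes fin: "finite S" and down: "\<And>i j. i \<le> j \<Longrightarrow> j \<in> S \<Longrightarrow> i \<in> S"
  shows "m < card S \<longleftrightarrow> m \<in> S"
proof
  assume "m \<in> S"
  then have "{..m} \<subseteq> S" using down by auto
  from card_mono[OF fin this] show "m < card S" by simp
next
  assume "m < card S"
  show "m \<in> S"
  proof (rule ccontr)
    assume "m \<notin> S"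
    then have "S \<subseteq> {..<m}" using down by (meson lessThan_iff linorder_not_le subsetI)
    from card_mono[OF _ this] \<open>m < card S\<close> show False by simp
  qed
qed

section \<open>Markov property for events of the past, and the law of the return time\<close>

locale finite_range_chain =
  fixes M :: "'w measure" and X :: "nat \<Rightarrow> 'w \<Rightarrow> 's::countable"
    and p :: "'s \<Rightarrow> 's \<Rightarrow> real" and nb :: "'s \<Rightarrow> 's set" and a :: 's
  assumes chain: "markov_chain M p X"
    and finite_nb: "finite (nb x)"
    and p_nonneg: "0 \<le> p x y"
    and sum_p: "(\<Sum>y\<in>nb x. p x y) = 1"
    and start: "AE w in M. X 0 w = a"
begin

sublocale prob_space M
  using chain by (simp add: markov_chain_def)

lemma X_measurable [measurable]: "X n \<in> M \<rightarrow>\<^sub>M count_space UNIV"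
  using chain by (simp add: markov_chain_def)

text \<open>A pointwise form of being determined by \<open>X 0\<close>, ..., \<open>X N\<close>.
  Such an event is a union of history classes, countably many because histories are finite lists
  over a countable type; measurability follows from that.\<close>

definition adapted :: "nat \<Rightarrow> ('w \<Rightarrow> bool) \<Rightarrow> bool" where
  "adapted N P \<longleftrightarrow> (\<forall>w\<in>space M. \<forall>w'\<in>space M. (\<forall>i\<le>N. X i w = X i w') \<longrightarrow> P w = P w')"

definition history :: "nat \<Rightarrow> 'w \<Rightarrow> 's list" where
  "history N w = map (\<lambda>i. X i w) [0..<Suc N]"

lemma history_measurable [measurable]: "history N \<in> M \<rightarrow>\<^sub>M count_space UNIV"
proof (induction N)
  case 0
  have "(\<lambda>w. [X 0 w]) \<in> M \<rightarrow>\<^sub>M count_space UNIV" by measurable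
  then show ?case by (simp add: history_def[abs_def])
next
  case (Suc N)
  have "(\<lambda>w. history N w @ [X (Suc N) w]) \<in> M \<rightarrow>\<^sub>M count_space UNIV"
    by (rule measurable_compose_countable[OF _ Suc]) measurable
  then show ?case by (simp add: history_def[abs_def])
qed

lemma history_eq_iff: "history N w = l \<longleftrightarrow> length l = Suc N \<and> (\<forall>i\<le>N. X i w = l ! i)"
  by (auto simp: history_def list_eq_iff_nth_eq less_Suc_eq_le simp del: upt_Suc)

lemma adapted_iff_history:
  assumes "adapted N P" "w \<in> space M"
  shows "P w \<longleftrightarrow> history N w \<in> history N ` {w\<in>space M. P w}"
proof
  assume "history N w \<in> history N ` {w\<in>space M. P w}"
  then obtain w' where w': "w' \<in> space M" "P w'" "history N w = history N w'" by auto
  then have "\<forall>i\<le>N. X i w = X i w'" using history_eq_iff[of N w' "history N w'"] history_eq_iff[of N w "history N w'"] by auto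
  with assms w' show "P w" unfolding adapted_def by blast
qed (use assms in auto)

lemma adapted_measurable:
  assumes "adapted N P"
  shows "Measurable.pred M P"
proof -
  have "Measurable.pred M (\<lambda>w. history N w \<in> history N ` {w\<in>space M. P w})" by measurable
  then show ?thesis
    by (rule measurable_cong[THEN iffD1, rotated]) (use adapted_iff_history[OF assms] in auto)
qed

lemma prob_step_history:
  "emeasure M {w\<in>space M. history N w = l \<and> X N w = x \<and> X (Suc N) w = y}
     = emeasure M {w\<in>space M. history N w = l \<and> X N w = x} * ennreal (p x y)"
proof (cases "length l = Suc N \<and> l ! N = x")
  case False
  then have "{w\<in>space M. history N w = l \<and> X N w = x \<and> X (Suc N) w = y} = {}"
      "{w\<in>space M. history N w = l \<and> X N w = x} = {}" by (auto simp: history_eq_iff)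
  then show ?thesis by (simp only: emeasure_empty mult_zero_left)
next
  case True
  then have *: "history N w = l \<and> X N w = x \<longleftrightarrow> (\<forall>i\<le>N. X i w = l ! i)" for w
    by (auto simp: history_eq_iff)
  have **: "{w\<in>space M. history N w = l \<and> X N w = x \<and> X (Suc N) w = y} =
     {w\<in>space M. X (Suc N) w = y \<and> (\<forall>i\<le>N. X i w = l ! i)}" using * by auto
  let ?B = "{w\<in>space M. \<forall>i\<le>N. X i w = l ! i}"
  have "prob {w\<in>space M. X (Suc N) w = y \<and> (\<forall>i\<le>N. X i w = l ! i)} = prob ?B * p x y"
  proof (cases "prob ?B > 0")
    case pos: True
    then have "\<P>(w in M. X (Suc N) w = y \<bar> \<forall>i\<le>N. X i w = l ! i) = p (l ! N) y"
      using chain unfolding markov_chain_def by blast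
    with pos True show ?thesis by (simp add: cond_prob_def field_simps)
  next
    \<comment> \<open>The Markov hypothesis is silent about a past of probability zero; there both
      sides vanish.\<close>
    case False
    then have "prob ?B = 0" using measure_nonneg[of M ?B] by linarith
    moreover have "prob {w\<in>space M. X (Suc N) w = y \<and> (\<forall>i\<le>N. X i w = l ! i)} \<le> prob ?B"
      by (intro finite_measure_mono) auto
    ultimately show ?thesis
      using measure_nonneg[of M "{w\<in>space M. X (Suc N) w = y \<and> (\<forall>i\<le>N. X i w = l ! i)}"] by simp
  qed
  then show ?thesis
    unfolding ** * by (simp add: emeasure_eq_measure ennreal_mult' p_nonneg ennreal_mult'')
qed

text \<open>Sum \<open>prob_step_history\<close> over the countably many histories that make up the
  event. With \<open>emeasure\<close> this sum is an integral over a counting measure.\<close>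

lemma prob_step:
  assumes P: "adapted N P"
  shows "prob {w\<in>space M. P w \<and> X N w = x \<and> X (Suc N) w = y} = prob {w\<in>space M. P w \<and> X N w = x} * p x y"
proof -
  define S where "S = history N ` {w\<in>space M. P w}"
  have eq: "{w\<in>space M. P w \<and> Q w} = {w\<in>space M. history N w \<in> S \<and> Q w}" for Q
    using adapted_iff_history[OF P] by (auto simp: S_def)
  have "emeasure M {w\<in>space M. P w \<and> X N w = x \<and> X (Suc N) w = y}
      = emeasure M {w\<in>space M. P w \<and> X N w = x} * ennreal (p x y)"
    unfolding eq by (simp add: emeasure_countable_partition prob_step_history nn_integral_multc)
  then show ?thesis
    by (simp add: emeasure_eq_measure p_nonneg flip: ennreal_mult')
qed

text \<open>The weights on \<open>nb x\<close> already add up to 1, so no mass is left for steps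
  outside it. This is what allows splitting an event over the finite set
  \<open>nb x\<close>.\<close>

lemma AE_step: "AE w in M. \<forall>N. X (Suc N) w \<in> nb (X N w)"
  unfolding AE_all_countable
proof
  fix N
  have "AE w in M. \<not> (X N w = x \<and> X (Suc N) w \<notin> nb x)" for x
  proof -
    have ad: "adapted N (\<lambda>_. True)" by (simp add: adapted_def)
    have "prob {w\<in>space M. X N w = x} = (\<Sum>y\<in>nb x. prob {w\<in>space M. X N w = x} * p x y)"
      by (simp add: sum_p flip: sum_distrib_left)
    also have "\<dots> = (\<Sum>y\<in>nb x. prob {w\<in>space M. X N w = x \<and> X (Suc N) w = y})"
      using prob_step[OF ad] by simp
    also have "\<dots> = prob (\<Union>y\<in>nb x. {w\<in>space M. X N w = x \<and> X (Suc N) w = y})"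
      by (intro finite_measure_finite_Union[symmetric] finite_nb) (auto simp: disjoint_family_on_def)
    also have "(\<Union>y\<in>nb x. {w\<in>space M. X N w = x \<and> X (Suc N) w = y}) =
        {w\<in>space M. X N w = x \<and> X (Suc N) w \<in> nb x}" by auto
    finally have eq: "prob {w\<in>space M. X N w = x} = prob {w\<in>space M. X N w = x \<and> X (Suc N) w \<in> nb x}" .
    have "prob ({w\<in>space M. X N w = x} - {w\<in>space M. X N w = x \<and> X (Suc N) w \<in> nb x}) = 0"
      by (subst finite_measure_Diff) (auto simp: eq)
    also have "{w\<in>space M. X N w = x} - {w\<in>space M. X N w = x \<and> X (Suc N) w \<in> nb x} =
        {w\<in>space M. X N w = x \<and> X (Suc N) w \<notin> nb x}" by auto
    finally have "prob {w\<in>space M. X N w = x \<and> X (Suc N) w \<notin> nb x} = 0" .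
    then show ?thesis by (subst AE_iff_measurable[OF _ refl]) (auto simp: emeasure_eq_measure)
  qed
  then have "AE w in M. \<forall>x. \<not> (X N w = x \<and> X (Suc N) w \<notin> nb x)" unfolding AE_all_countable by blast
  then show "AE w in M. X (Suc N) w \<in> nb (X N w)" by eventually_elim auto
qed

lemma prob_split_step:
  assumes P: "adapted N P" and R [measurable]: "Measurable.pred M R"
  shows "prob {w\<in>space M. P w \<and> X N w = x \<and> R w} =
    (\<Sum>y\<in>nb x. prob {w\<in>space M. (P w \<and> X N w = x) \<and> X (Suc N) w = y \<and> R w})"
proof -
  note [measurable] = adapted_measurable[OF P]
  have "prob {w\<in>space M. P w \<and> X N w = x \<and> R w} =
      prob (\<Union>y\<in>nb x. {w\<in>space M. (P w \<and> X N w = x) \<and> X (Suc N) w = y \<and> R w})"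
  proof (rule measure_eq_AE)
    show "AE w in M. w \<in> {w\<in>space M. P w \<and> X N w = x \<and> R w} \<longleftrightarrow>
        w \<in> (\<Union>y\<in>nb x. {w\<in>space M. (P w \<and> X N w = x) \<and> X (Suc N) w = y \<and> R w})"
      using AE_step by eventually_elim auto
    show "(\<Union>y\<in>nb x. {w\<in>space M. (P w \<and> X N w = x) \<and> X (Suc N) w = y \<and> R w}) \<in> events"
      by (intro sets.finite_UN finite_nb) measurable
  qed measurable
  also have "\<dots> = (\<Sum>y\<in>nb x. prob {w\<in>space M. (P w \<and> X N w = x) \<and> X (Suc N) w = y \<and> R w})"
    by (intro finite_measure_finite_Union finite_nb) (auto simp: disjoint_family_on_def)
  finally show ?thesis .
qed

text \<open>The induction has to generalise the past event: after one step the condition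
  \<open>X N w = x\<close> joins \<open>P\<close>, and the conjunction is adapted at time
  \<open>Suc N\<close>.\<close>

lemma prob_first_hit:
  assumes "adapted N P"
  shows "prob {w\<in>space M. P w \<and> X N w = x \<and> ((\<forall>i<n. X (N + i) w \<noteq> a) \<and> X (N + n) w = a)}
     = prob {w\<in>space M. P w \<and> X N w = x} * hit_prob p nb a n x"
  using assms
proof (induction n arbitrary: N P x)
  case 0
  have "{w\<in>space M. P w \<and> X N w = x \<and> X N w = a} = (if x = a then {w\<in>space M. P w \<and> X N w = x} else {})"
    by auto
  then show ?case by simp
next
  case (Suc n)
  show ?case
  proof (cases "x = a")
    case True
    then have "{w\<in>space M. P w \<and> X N w = x \<and> ((\<forall>i<Suc n. X (N + i) w \<noteq> a) \<and> X (N + Suc n) w = a)} = {}"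
      by auto
    then show ?thesis using True by (simp only: measure_empty hit_prob.simps if_True mult_zero_right simp_thms)
  next
    case False
    let ?R = "\<lambda>w. (\<forall>i<n. X (Suc N + i) w \<noteq> a) \<and> X (Suc N + n) w = a"
    have ad: "adapted (Suc N) (\<lambda>w. P w \<and> X N w = x)"
      using Suc.prems unfolding adapted_def by (metis le_SucI order_refl)
    have "prob {w\<in>space M. P w \<and> X N w = x \<and> ((\<forall>i<Suc n. X (N + i) w \<noteq> a) \<and> X (N + Suc n) w = a)}
        = prob {w\<in>space M. P w \<and> X N w = x \<and> ?R w}"
      using False by (intro arg_cong[where f = prob]) (auto simp: All_less_Suc2)
    also have "\<dots> = (\<Sum>y\<in>nb x. prob {w\<in>space M. (P w \<and> X N w = x) \<and> X (Suc N) w = y \<and> ?R w})"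
      by (rule prob_split_step[OF Suc.prems]) measurable
    also have "\<dots> = (\<Sum>y\<in>nb x. prob {w\<in>space M. (P w \<and> X N w = x) \<and> X (Suc N) w = y} * hit_prob p nb a n y)"
      by (intro sum.cong refl Suc.IH ad)
    also have "\<dots> = (\<Sum>y\<in>nb x. prob {w\<in>space M. P w \<and> X N w = x} * (p x y * hit_prob p nb a n y))"
      using prob_step[OF Suc.prems] by (intro sum.cong refl) (simp add: mult.assoc conj_assoc)
    also have "\<dots> = prob {w\<in>space M. P w \<and> X N w = x} * hit_prob p nb a (Suc n) x"
      using False by (simp add: sum_distrib_left)
    finally show ?thesis .
  qed
qed

text \<open>The law of the return time to \<open>a\<close>, indexed by the true time, hence 0 at
  \<open>t = 0\<close>. At this stage it may be defective, with total mass below 1.\<close>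

definition gap_prob :: "nat \<Rightarrow> real" where
  "gap_prob t = (case t of 0 \<Rightarrow> 0 | Suc n \<Rightarrow> \<Sum>y\<in>nb a. p a y * hit_prob p nb a n y)"

definition gap :: "nat \<Rightarrow> nat \<Rightarrow> 'w \<Rightarrow> bool" where
  "gap m n w \<longleftrightarrow> (\<forall>i. m < i \<and> i < n \<longrightarrow> X i w \<noteq> a) \<and> X n w = a"

lemma gap_measurable [measurable]: "Measurable.pred M (gap m n)"
  unfolding gap_def[abs_def] by measurable

lemma prob_gap:
  assumes P: "adapted N P" and t: "t > 0"
  shows "prob {w\<in>space M. P w \<and> X N w = a \<and> gap N (N + t) w} = prob {w\<in>space M. P w \<and> X N w = a} * gap_prob t"
proof -
  obtain n where n: "t = Suc n" using t by (cases t) auto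
  let ?R = "\<lambda>w. (\<forall>i<n. X (Suc N + i) w \<noteq> a) \<and> X (Suc N + n) w = a"
  have gap_iff: "gap N (N + t) w \<longleftrightarrow> ?R w" for w
  proof -
    have "(\<forall>i. N < i \<and> i < N + t \<longrightarrow> X i w \<noteq> a) \<longleftrightarrow> (\<forall>i<n. X (Suc N + i) w \<noteq> a)"
    proof (intro iffI allI impI)
      fix i assume *: "\<forall>i<n. X (Suc N + i) w \<noteq> a" and i: "N < i \<and> i < N + t"
      then have "i - Suc N < n" "Suc N + (i - Suc N) = i" by (auto simp: n)
      then show "X i w \<noteq> a" using * by metis
    qed (auto simp: n)
    then show ?thesis by (simp add: gap_def n)
  qed
  have ad: "adapted (Suc N) (\<lambda>w. P w \<and> X N w = a)"
    using P unfolding adapted_def by (metis le_SucI order_refl)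
  have "prob {w\<in>space M. P w \<and> X N w = a \<and> ?R w}
      = (\<Sum>y\<in>nb a. prob {w\<in>space M. (P w \<and> X N w = a) \<and> X (Suc N) w = y \<and> ?R w})"
    by (rule prob_split_step[OF P]) measurable
  also have "\<dots> = (\<Sum>y\<in>nb a. prob {w\<in>space M. (P w \<and> X N w = a) \<and> X (Suc N) w = y} * hit_prob p nb a n y)"
    by (intro sum.cong refl prob_first_hit ad)
  also have "\<dots> = (\<Sum>y\<in>nb a. prob {w\<in>space M. P w \<and> X N w = a} * (p a y * hit_prob p nb a n y))"
    using prob_step[OF P] by (intro sum.cong refl) (simp add: mult.assoc conj_assoc)
  also have "\<dots> = prob {w\<in>space M. P w \<and> X N w = a} * gap_prob t"
    by (simp add: gap_prob_def n sum_distrib_left)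
  finally show ?thesis unfolding gap_iff .
qed

lemma gap_unique:
  assumes "gap m n w" "gap m n' w" "m < n" "m < n'"
  shows "n = n'"
  using assms unfolding gap_def by (metis linorder_neqE_nat)

text \<open>Says that the first \<open>m\<close> return times are \<open>t 0\<close>,
  \<open>t 1\<close>, ... in terms of \<open>X\<close> at deterministic times only, so that it makes
  sense before recurrence is known.\<close>

definition renewals :: "(nat \<Rightarrow> nat) \<Rightarrow> nat \<Rightarrow> 'w \<Rightarrow> bool" where
  "renewals t m w \<longleftrightarrow> X 0 w = a \<and> (\<forall>j<m. gap (\<Sum>i<j. t i) (\<Sum>i<Suc j. t i) w)"

lemma renewals_measurable [measurable]: "Measurable.pred M (renewals t m)"
  unfolding renewals_def[abs_def] by measurable

text \<open>For a fixed pattern \<open>t\<close>, visit number \<open>m\<close> happens at the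
  deterministic time \<open>N\<close>, so the Markov property at a fixed time does the work of the
  strong Markov property.\<close>

lemma prob_renewals:
  assumes t: "\<And>j. j < m \<Longrightarrow> t j > 0"
  shows "prob {w\<in>space M. renewals t m w} = (\<Prod>j<m. gap_prob (t j))"
  using assms
proof (induction m)
  case 0
  have "prob {w\<in>space M. X 0 w = a} = 1" using start by (subst prob_eq_1) auto
  then show ?case by (simp add: renewals_def)
next
  case (Suc m)
  define N where "N = (\<Sum>i<m. t i)"
  have ad: "adapted N (renewals t m)"
  proof -
    have "(\<Sum>i<Suc j. t i) \<le> N" if "j < m" for j
      unfolding N_def using that by (intro sum_mono2) auto
    then show ?thesis unfolding adapted_def renewals_def gap_def
      by (smt (verit, best) le_trans less_imp_le_nat zero_le)
  qed
  have XN: "X N w = a" if "renewals t m w" for w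
  proof (cases m)
    case 0 then show ?thesis using that by (simp add: renewals_def N_def)
  next
    case (Suc k) then show ?thesis using that by (auto simp: renewals_def N_def gap_def)
  qed
  have "prob {w\<in>space M. renewals t (Suc m) w} =
      prob {w\<in>space M. renewals t m w \<and> X N w = a \<and> gap N (N + t m) w}"
    using XN by (intro arg_cong[where f = prob]) (auto simp: renewals_def N_def less_Suc_eq)
  also have "\<dots> = prob {w\<in>space M. renewals t m w \<and> X N w = a} * gap_prob (t m)"
    using Suc.prems by (intro prob_gap ad) auto
  also have "{w\<in>space M. renewals t m w \<and> X N w = a} = {w\<in>space M. renewals t m w}"
    using XN by auto
  also have "prob \<dots> = (\<Prod>j<m. gap_prob (t j))" using Suc by auto
  finally show ?case by simp
qed

section \<open>Renewal equation and generating functions\<close>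

lemma chain_prob_bounds: "0 \<le> chain_prob p nb a n x \<and> chain_prob p nb a n x \<le> 1"
proof (induction n arbitrary: x)
  case (Suc n)
  have "(\<Sum>y\<in>nb x. p x y * chain_prob p nb a n y) \<le> (\<Sum>y\<in>nb x. p x y * 1)"
    using Suc p_nonneg by (intro sum_mono mult_left_mono) auto
  then show ?case using Suc p_nonneg by (auto simp: sum_p intro!: sum_nonneg)
qed simp

lemma hit_prob_nonneg: "0 \<le> hit_prob p nb a n x"
  by (induction n arbitrary: x) (auto intro!: sum_nonneg mult_nonneg_nonneg p_nonneg)

lemma sum_hit_prob_le: "(\<Sum>k<n. hit_prob p nb a k x) \<le> 1"
proof (induction n arbitrary: x)
  case (Suc n)
  show ?case
  proof (cases "x = a")
    case False
    have "(\<Sum>k<Suc n. hit_prob p nb a k x) = (\<Sum>k<n. \<Sum>y\<in>nb x. p x y * hit_prob p nb a k y)"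
      using False by (simp add: sum.lessThan_Suc_shift del: sum.lessThan_Suc)
    also have "\<dots> = (\<Sum>y\<in>nb x. p x y * (\<Sum>k<n. hit_prob p nb a k y))"
      by (subst sum.swap) (simp add: sum_distrib_left)
    also have "\<dots> \<le> (\<Sum>y\<in>nb x. p x y * 1)"
      using Suc p_nonneg by (intro sum_mono mult_left_mono) auto
    finally show ?thesis by (simp add: sum_p)
  qed (simp add: sum.lessThan_Suc_shift del: sum.lessThan_Suc)
qed simp

lemma gap_prob_nonneg: "0 \<le> gap_prob t"
  by (auto simp: gap_prob_def hit_prob_nonneg p_nonneg intro!: sum_nonneg mult_nonneg_nonneg split: nat.split)

lemma sum_gap_prob_le: "(\<Sum>t<n. gap_prob t) \<le> 1"
proof -
  have "(\<Sum>t<n. gap_prob t) \<le> (\<Sum>t<Suc n. gap_prob t)" by (simp add: gap_prob_nonneg)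
  also have "\<dots> = (\<Sum>k<n. \<Sum>y\<in>nb a. p a y * hit_prob p nb a k y)"
    by (simp add: sum.lessThan_Suc_shift gap_prob_def del: sum.lessThan_Suc)
  also have "\<dots> = (\<Sum>y\<in>nb a. p a y * (\<Sum>k<n. hit_prob p nb a k y))"
    by (subst sum.swap) (simp add: sum_distrib_left)
  also have "\<dots> \<le> (\<Sum>y\<in>nb a. p a y * 1)"
    using sum_hit_prob_le p_nonneg by (intro sum_mono mult_left_mono) auto
  finally show ?thesis by (simp add: sum_p)
qed

lemma summable_gap_prob: "summable gap_prob"
  by (rule summableI_nonneg_bounded[OF gap_prob_nonneg sum_gap_prob_le])

lemma suminf_gap_prob_le: "suminf gap_prob \<le> 1"
  by (rule suminf_le_const[OF summable_gap_prob sum_gap_prob_le])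

text \<open>Decomposition at the first visit to \<open>a\<close>, by induction on the two
  recursions. From \<open>x = a\<close> only the term \<open>k = 0\<close> survives.\<close>

lemma chain_prob_renewal:
  "chain_prob p nb a n x = (\<Sum>k\<le>n. hit_prob p nb a k x * chain_prob p nb a (n - k) a)"
proof (induction n arbitrary: x)
  case (Suc n)
  show ?case
  proof (cases "x = a")
    case True
    then show ?thesis by (simp add: sum.atMost_Suc_shift del: sum.atMost_Suc)
  next
    case False
    have "chain_prob p nb a (Suc n) x =
        (\<Sum>y\<in>nb x. \<Sum>k\<le>n. p x y * hit_prob p nb a k y * chain_prob p nb a (n - k) a)"
      by (simp add: Suc[of y for y] sum_distrib_left mult.assoc)
    also have "\<dots> = (\<Sum>k\<le>n. hit_prob p nb a (Suc k) x * chain_prob p nb a (n - k) a)"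
      using False by (subst sum.swap) (simp add: sum_distrib_right)
    finally show ?thesis using False
      by (simp add: sum.atMost_Suc_shift del: sum.atMost_Suc chain_prob.simps(2) hit_prob.simps(2))
  qed
qed simp

lemma chain_prob_renewal_gap:
  "chain_prob p nb a n a = of_bool (n = 0) + (\<Sum>k\<le>n. gap_prob k * chain_prob p nb a (n - k) a)"
proof (cases n)
  case 0
  then show ?thesis by (simp add: gap_prob_def)
next
  case (Suc m)
  have "chain_prob p nb a (Suc m) a =
      (\<Sum>y\<in>nb a. \<Sum>k\<le>m. p a y * hit_prob p nb a k y * chain_prob p nb a (m - k) a)"
    by (simp add: chain_prob_renewal[of m y for y] sum_distrib_left mult.assoc)
  also have "\<dots> = (\<Sum>k\<le>m. gap_prob (Suc k) * chain_prob p nb a (m - k) a)"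
    by (subst sum.swap) (simp add: sum_distrib_right gap_prob_def)
  also have "\<dots> = (\<Sum>k\<le>Suc m. gap_prob k * chain_prob p nb a (Suc m - k) a)"
    by (simp add: sum.atMost_Suc_shift gap_prob_def del: sum.atMost_Suc)
  finally show ?thesis using Suc by (simp del: chain_prob.simps sum.atMost_Suc)
qed

text \<open>Multiplying the renewal equation by \<open>s ^ n\<close> and summing gives F U = U - 1
  as a Cauchy product. The bound by \<open>suminf gap_prob\<close> is later read backwards: the
  limit \<open>s\<close> to 1 bounds the total mass from below.\<close>

lemma generating_functions:
  assumes s: "0 < s" "s < 1"
  shows "(\<Sum>n. s ^ n * chain_prob p nb a n a) * (1 - (\<Sum>n. s ^ n * gap_prob n)) = 1"
    and "(\<Sum>n. s ^ n * gap_prob n) \<le> suminf gap_prob"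
    and "summable (\<lambda>n. s ^ n * gap_prob n)"
proof -
  define u where "u n = s ^ n * chain_prob p nb a n a" for n
  define f where "f n = s ^ n * gap_prob n" for n
  have u: "summable (\<lambda>n. norm (u n))"
  proof (rule summable_comparison_test'[of "\<lambda>n. s ^ n" 0])
    show "summable (\<lambda>n. s ^ n)" using s by (intro summable_geometric) simp
    show "norm (norm (u n)) \<le> s ^ n" for n
      using s chain_prob_bounds[of n a] by (simp add: u_def abs_mult mult_left_le)
  qed
  have f_le: "norm (f n) \<le> gap_prob n" for n
    using s gap_prob_nonneg[of n] by (simp add: f_def abs_mult mult_left_le_one_le power_le_one)
  have f: "summable (\<lambda>n. norm (f n))"
    by (rule summable_comparison_test'[OF summable_gap_prob, of 0]) (use f_le in simp)
  then show f': "summable (\<lambda>n. s ^ n * gap_prob n)"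
    unfolding f_def[symmetric] by (rule summable_norm_cancel)
  show "(\<Sum>n. s ^ n * gap_prob n) \<le> suminf gap_prob"
    using f_le f' by (intro suminf_le summable_gap_prob) (auto simp: f_def abs_le_iff)
  have "(\<lambda>n. \<Sum>i\<le>n. f i * u (n - i)) sums (suminf f * suminf u)"
    by (rule Cauchy_product_sums[OF f u])
  moreover have "(\<Sum>i\<le>n. f i * u (n - i)) = u n - of_bool (n = 0)" for n
  proof -
    have "(\<Sum>i\<le>n. f i * u (n - i)) = (\<Sum>i\<le>n. s ^ n * (gap_prob i * chain_prob p nb a (n - i) a))"
      by (intro sum.cong refl) (auto simp: f_def u_def power_add[symmetric] mult_ac simp flip: power_add)
    also have "\<dots> = s ^ n * (chain_prob p nb a n a - of_bool (n = 0))"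
      by (subst chain_prob_renewal_gap[of n]) (simp add: sum_distrib_left)
    finally show ?thesis by (cases n) (auto simp: u_def)
  qed
  moreover have "(\<lambda>n. u n - of_bool (n = 0)) sums (suminf u - 1)"
  proof (rule sums_diff)
    show "u sums suminf u" using summable_norm_cancel[OF u] by (rule summable_sums)
    have "(\<lambda>n. of_bool (n = 0) :: real) sums (\<Sum>n\<in>{0::nat}. of_bool (n = 0))" by (rule sums_finite) auto
    then show "(\<lambda>n. of_bool (n = (0::nat)) :: real) sums 1" by simp
  qed
  ultimately have "suminf f * suminf u = suminf u - 1" by (simp add: sums_unique2)
  then show "(\<Sum>n. s ^ n * chain_prob p nb a n a) * (1 - (\<Sum>n. s ^ n * gap_prob n)) = 1"
    by (simp add: u_def[symmetric] f_def[symmetric] algebra_simps)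
qed

end

section \<open>Recurrent chains: the visits to \<open>a\<close> as a renewal process\<close>

locale recurrent_chain = finite_range_chain M X p nb a
  for M :: "'w measure" and X :: "nat \<Rightarrow> 'w \<Rightarrow> 's::countable"
    and p :: "'s \<Rightarrow> 's \<Rightarrow> real" and nb :: "'s \<Rightarrow> 's set" and a :: 's +
  assumes suminf_gap_prob: "suminf gap_prob = 1"
begin

lemma gap_prob_sums: "(\<lambda>n. gap_prob (Suc n)) sums 1"
proof -
  have "gap_prob sums 1" using summable_gap_prob suminf_gap_prob by (simp add: sums_iff)
  moreover have "gap_prob 0 = 0" by (simp add: gap_prob_def)
  ultimately show ?thesis using sums_Suc_iff[of gap_prob 1] by simp
qed

text \<open>Given a visit at time \<open>N\<close>, the disjoint events "next visit exactly
  \<open>Suc t\<close> steps later" have conditional probabilities adding up to 1. So a last visit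
  at time \<open>N\<close> has probability 0, for each of the countably many
  \<open>N\<close>.\<close>

lemma AE_infinite_visits: "AE w in M. X 0 w = a \<and> (\<forall>N. X N w = a \<longrightarrow> (\<exists>n>N. X n w = a))"
proof -
  have "AE w in M. \<not> (X N w = a \<and> (\<forall>n>N. X n w \<noteq> a))" for N
  proof -
    have ad: "adapted N (\<lambda>_. True)" by (simp add: adapted_def)
    let ?A = "{w\<in>space M. X N w = a}"
    let ?D = "\<lambda>t. {w\<in>space M. X N w = a \<and> gap N (N + Suc t) w}"
    have disj: "disjoint_family ?D"
      unfolding disjoint_family_on_def
    proof (intro ballI impI)
      fix s t :: nat assume "s \<noteq> t"
      then show "?D s \<inter> ?D t = {}"
        using gap_unique[of N "N + Suc s" _ "N + Suc t"] by auto
    qed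
    have "(\<lambda>t. prob (?D t)) sums prob (\<Union>t. ?D t)"
      by (intro finite_measure_UNION disj) auto
    moreover have "prob (?D t) = prob ?A * gap_prob (Suc t)" for t
      using prob_gap[OF ad, of "Suc t"] by simp
    ultimately have "prob (\<Union>t. ?D t) = prob ?A * 1"
      using sums_mult[OF gap_prob_sums, of "prob ?A"] by (simp add: sums_unique2)
    moreover have "(\<Union>t. ?D t) \<subseteq> ?A" by auto
    ultimately have "prob (?A - (\<Union>t. ?D t)) = 0"
      by (subst finite_measure_Diff) auto
    moreover have "{w\<in>space M. X N w = a \<and> (\<forall>n>N. X n w \<noteq> a)} \<subseteq> ?A - (\<Union>t. ?D t)"
      by (auto simp: gap_def)
    then have "prob {w\<in>space M. X N w = a \<and> (\<forall>n>N. X n w \<noteq> a)} \<le> prob (?A - (\<Union>t. ?D t))"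
      by (intro finite_measure_mono) auto
    ultimately have "prob {w\<in>space M. X N w = a \<and> (\<forall>n>N. X n w \<noteq> a)} = 0"
      using measure_nonneg[of M "{w\<in>space M. X N w = a \<and> (\<forall>n>N. X n w \<noteq> a)}"] by linarith
    then show ?thesis by (subst AE_iff_measurable[OF _ refl]) (auto simp: emeasure_eq_measure)
  qed
  then have "AE w in M. \<forall>N. \<not> (X N w = a \<and> (\<forall>n>N. X n w \<noteq> a))" unfolding AE_all_countable by blast
  with start show ?thesis by eventually_elim auto
qed

text \<open>The visit at time 0 has number 0. On a path that stops returning, \<open>LEAST\<close>
  has an unspecified value; the facts about visits are therefore stated for \<open>recurs\<close>
  paths.\<close>

primrec arrival :: "nat \<Rightarrow> 'w \<Rightarrow> nat" where
  "arrival 0 w = 0"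
| "arrival (Suc i) w = (LEAST n. arrival i w < n \<and> X n w = a)"

definition waiting :: "nat \<Rightarrow> 'w \<Rightarrow> nat" where
  "waiting i w = arrival (Suc i) w - arrival i w"

lemma arrival_measurable [measurable]: "arrival i \<in> M \<rightarrow>\<^sub>M count_space UNIV"
proof (induction i)
  case 0
  show ?case by (simp add: arrival.simps(1)[abs_def])
next
  case (Suc i)
  note [measurable] = Suc
  have "(\<lambda>w. LEAST n. arrival i w < n \<and> X n w = a) \<in> M \<rightarrow>\<^sub>M count_space UNIV" by measurable
  then show ?case by (simp add: arrival.simps(2)[abs_def])
qed

lemma waiting_measurable [measurable]: "waiting i \<in> M \<rightarrow>\<^sub>M count_space UNIV"
  unfolding waiting_def[abs_def] by measurable

definition recurs :: "'w \<Rightarrow> bool" where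
  "recurs w \<longleftrightarrow> X 0 w = a \<and> (\<forall>N. X N w = a \<longrightarrow> (\<exists>n>N. X n w = a))"

lemma AE_recurs: "AE w in M. recurs w"
  using AE_infinite_visits unfolding recurs_def .

lemma arrival_Suc:
  assumes "recurs w"
  shows "X (arrival i w) w = a" "arrival i w < arrival (Suc i) w" "gap (arrival i w) (arrival (Suc i) w) w"
proof -
  have step: "arrival i w < arrival (Suc i) w \<and> X (arrival (Suc i) w) w = a" if "X (arrival i w) w = a" for i
  proof -
    have "\<exists>n. arrival i w < n \<and> X n w = a" using assms that by (auto simp: recurs_def)
    from LeastI_ex[OF this] show ?thesis by simp
  qed
  show 1: "X (arrival i w) w = a"
  proof (induction i)
    case 0 then show ?case using assms by (simp add: recurs_def)
  qed (use step in blast)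
  from step[OF 1] show "arrival i w < arrival (Suc i) w" by simp
  show "gap (arrival i w) (arrival (Suc i) w) w"
    using step[OF 1] unfolding gap_def
    by (auto dest: not_less_Least simp: arrival.simps)
qed

lemma arrival_eq_sum:
  assumes "recurs w"
  shows "arrival m w = (\<Sum>i<m. waiting i w)"
proof (induction m)
  case (Suc m)
  then show ?case using arrival_Suc(2)[OF assms, of m] by (simp add: waiting_def del: arrival.simps(2))
qed simp

lemma waiting_pos: "recurs w \<Longrightarrow> 0 < waiting i w"
  using arrival_Suc(2)[of w i] by (simp add: waiting_def del: arrival.simps)

text \<open>Once the first \<open>m\<close> waiting times agree with \<open>t\<close>, the partial
  sum of \<open>t\<close> is \<open>arrival m w\<close>, and the end of the next gap is
  unique.\<close>

lemma renewals_iff_waiting: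
  assumes w: "recurs w" and t: "\<And>j. j < m \<Longrightarrow> t j > 0"
  shows "renewals t m w \<longleftrightarrow> (\<forall>j<m. waiting j w = t j)"
  using t
proof (induction m)
  case 0
  then show ?case using w by (simp add: renewals_def recurs_def)
next
  case (Suc m)
  have "renewals t (Suc m) w \<longleftrightarrow> renewals t m w \<and> gap (\<Sum>i<m. t i) (\<Sum>i<Suc m. t i) w"
    by (auto simp: renewals_def less_Suc_eq)
  also have "\<dots> \<longleftrightarrow> (\<forall>j<m. waiting j w = t j) \<and> gap (\<Sum>i<m. t i) (\<Sum>i<Suc m. t i) w"
    using Suc by auto
  also have "\<dots> \<longleftrightarrow> (\<forall>j<m. waiting j w = t j) \<and> waiting m w = t m"
  proof (intro conj_cong refl)
    assume "\<forall>j<m. waiting j w = t j"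
    then have s: "(\<Sum>i<m. t i) = arrival m w" using arrival_eq_sum[OF w] by simp
    have "arrival (Suc m) w = arrival m w + waiting m w"
      using arrival_eq_sum[OF w, of "Suc m"] arrival_eq_sum[OF w, of m] by simp
    then show "gap (\<Sum>i<m. t i) (\<Sum>i<Suc m. t i) w \<longleftrightarrow> waiting m w = t m"
      using arrival_Suc(2,3)[OF w, of m] gap_unique[of "arrival m w" "arrival (Suc m) w" w "arrival m w + t m"]
        Suc.prems[of m] s by (auto simp del: arrival.simps)
  qed
  also have "\<dots> \<longleftrightarrow> (\<forall>j<Suc m. waiting j w = t j)" by (auto simp: less_Suc_eq)
  finally show ?case .
qed

definition gap_pmf :: "nat pmf" where "gap_pmf = embed_pmf gap_prob"

lemma pmf_gap_pmf: "pmf gap_pmf n = gap_prob n"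
  unfolding gap_pmf_def
proof (rule pmf_embed_pmf[OF gap_prob_nonneg])
  have "(\<integral>\<^sup>+ n. ennreal (gap_prob n) \<partial>count_space UNIV) = ennreal (suminf gap_prob)"
    using gap_prob_nonneg summable_gap_prob
    by (simp add: nn_integral_count_space_nat suminf_ennreal_eq sums_iff)
  then show "(\<integral>\<^sup>+ n. ennreal (gap_prob n) \<partial>count_space UNIV) = 1" by (simp add: suminf_gap_prob)
qed

lemma emeasure_waiting_eq:
  "emeasure M {w\<in>space M. \<forall>j<m. waiting j w = t j} = (\<Prod>j<m. ennreal (pmf gap_pmf (t j)))"
proof (cases "\<forall>j<m. t j > 0")
  case True
  have "emeasure M {w\<in>space M. \<forall>j<m. waiting j w = t j} = emeasure M {w\<in>space M. renewals t m w}"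
    using AE_recurs by (intro emeasure_eq_AE) (auto simp: renewals_iff_waiting True elim!: eventually_mono)
  then show ?thesis
    using True by (simp add: emeasure_eq_measure prob_renewals pmf_gap_pmf prod_ennreal gap_prob_nonneg)
next
  \<comment> \<open>Waiting times are almost surely positive and \<open>gap_prob 0 = 0\<close>, so
    both sides vanish.\<close>
  case False
  then obtain j where j: "j < m" "t j = 0" by auto
  have "AE w in M. \<not> (\<forall>j<m. waiting j w = t j)"
    using AE_recurs by eventually_elim (use j waiting_pos in \<open>metis less_irrefl\<close>)
  then have "emeasure M {w\<in>space M. \<forall>j<m. waiting j w = t j} = 0"
    by (subst (asm) AE_iff_measurable[OF _ refl]) auto
  moreover have "(\<Prod>j<m. ennreal (pmf gap_pmf (t j))) = 0"
    using j by (intro prod_zero) (auto simp: pmf_gap_pmf gap_prob_def intro!: bexI[of _ j])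
  ultimately show ?thesis by simp
qed

text \<open>A mixed statement that makes the induction on \<open>n\<close> work: coordinate
  \<open>j\<close> is split over its countably many values, and each value moves it from the
  set-valued part to the fixed part.\<close>

lemma emeasure_waiting_in_aux:
  "emeasure M {w\<in>space M. (\<forall>i<j. waiting i w = t i) \<and> (\<forall>i<n. waiting (j + i) w \<in> A i)}
    = (\<Prod>i<j. ennreal (pmf gap_pmf (t i))) * (\<Prod>i<n. emeasure gap_pmf (A i))"
proof (induction n arbitrary: j t A)
  case 0
  then show ?case by (simp add: emeasure_waiting_eq)
next
  case (Suc n)
  let ?Q = "\<lambda>w. (\<forall>i<j. waiting i w = t i) \<and> (\<forall>i<n. waiting (Suc j + i) w \<in> A (Suc i))"
  let ?c = "\<Prod>i<j. ennreal (pmf gap_pmf (t i))" and ?d = "\<Prod>i<n. emeasure gap_pmf (A (Suc i))"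
  have "emeasure M {w\<in>space M. (\<forall>i<j. waiting i w = t i) \<and> (\<forall>i<Suc n. waiting (j + i) w \<in> A i)} =
      emeasure M {w\<in>space M. waiting j w \<in> A 0 \<and> ?Q w}"
    by (intro arg_cong[where f = "emeasure M"]) (auto simp: All_less_Suc2)
  also have "\<dots> = (\<integral>\<^sup>+ v. emeasure M {w\<in>space M. waiting j w = v \<and> ?Q w} \<partial>count_space (A 0))"
    by (rule emeasure_countable_partition) measurable
  also have "\<dots> = (\<integral>\<^sup>+ v. ?c * ?d * ennreal (pmf gap_pmf v) \<partial>count_space (A 0))"
  proof (rule nn_integral_cong)
    fix v
    have upd: "(\<forall>i<Suc j. waiting i w = (t(j := v)) i) \<longleftrightarrow> waiting j w = v \<and> (\<forall>i<j. waiting i w = t i)" for w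
    proof -
      have "(\<forall>i<j. waiting i w = (t(j := v)) i) \<longleftrightarrow> (\<forall>i<j. waiting i w = t i)"
        by (rule all_cong) simp
      then show ?thesis by (simp only: All_less_Suc fun_upd_same)
    qed
    have "(\<Prod>i<j. ennreal (pmf gap_pmf ((t(j := v)) i))) = ?c" by (rule prod.cong) auto
    then have prod_upd: "(\<Prod>i<Suc j. ennreal (pmf gap_pmf ((t(j := v)) i))) = ?c * ennreal (pmf gap_pmf v)"
      by simp
    have "emeasure M {w\<in>space M. waiting j w = v \<and> ?Q w} = ?c * ennreal (pmf gap_pmf v) * ?d"
      using Suc.IH[of "Suc j" "t(j := v)" "\<lambda>i. A (Suc i)"] unfolding upd prod_upd conj_assoc .
    then show "emeasure M {w\<in>space M. waiting j w = v \<and> ?Q w} = ?c * ?d * ennreal (pmf gap_pmf v)"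
      by (simp only: mult_ac)
  qed
  also have "\<dots> = ?c * ?d * emeasure gap_pmf (A 0)"
    by (simp add: nn_integral_cmult nn_integral_pmf)
  finally show ?case by (simp add: prod.lessThan_Suc_shift mult_ac del: prod.lessThan_Suc)
qed

lemma emeasure_waiting_in:
  "emeasure M {w\<in>space M. \<forall>i<n. waiting i w \<in> A i} = (\<Prod>i<n. emeasure gap_pmf (A i))"
  using emeasure_waiting_in_aux[of 0 "\<lambda>_. 0" n A] by simp

lemma emeasure_waiting_in_finite:
  assumes "finite J"
  shows "emeasure M {w\<in>space M. \<forall>i\<in>J. waiting i w \<in> A i} = (\<Prod>i\<in>J. emeasure gap_pmf (A i))"
proof -
  obtain n where n: "J \<subseteq> {..<n}" using assms finite_nat_iff_bounded by auto
  define B where "B i = (if i \<in> J then A i else UNIV)" for i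
  have "{w\<in>space M. \<forall>i\<in>J. waiting i w \<in> A i} = {w\<in>space M. \<forall>i<n. waiting i w \<in> B i}"
    using n by (auto simp: B_def)
  also have "emeasure M \<dots> = (\<Prod>i<n. emeasure gap_pmf (B i))" by (rule emeasure_waiting_in)
  also have "\<dots> = (\<Prod>i\<in>J. emeasure gap_pmf (B i))"
    using n by (intro prod.mono_neutral_right) (auto simp: B_def measure_pmf.emeasure_space_1[simplified])
  also have "\<dots> = (\<Prod>i\<in>J. emeasure gap_pmf (A i))" by (intro prod.cong) (auto simp: B_def)
  finally show ?thesis .
qed

lemma distr_waiting: "distr M (count_space UNIV) (waiting i) = measure_pmf gap_pmf"
proof (rule measure_eqI)
  fix A :: "nat set"
  have "waiting i -` A \<inter> space M = {w\<in>space M. \<forall>i\<in>{i}. waiting i w \<in> A}" by auto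
  then show "emeasure (distr M (count_space UNIV) (waiting i)) A = emeasure (measure_pmf gap_pmf) A"
    using emeasure_waiting_in_finite[of "{i}" "\<lambda>_. A"] by (simp add: emeasure_distr)
qed simp

lemma indep_waiting: "indep_vars (\<lambda>_. count_space UNIV) waiting UNIV"
  unfolding indep_vars_def2
proof (intro conjI ballI indep_setsI)
  fix B :: "nat \<Rightarrow> 'w set" and J :: "nat set"
  assume J: "J \<noteq> {}" "J \<subseteq> UNIV" "finite J"
    and B: "\<forall>j\<in>J. B j \<in> {waiting j -` A \<inter> space M |A. A \<in> sets (count_space UNIV)}"
  then have "\<forall>j\<in>J. \<exists>A. B j = waiting j -` A \<inter> space M" by auto
  then obtain A where A: "\<And>j. j \<in> J \<Longrightarrow> B j = waiting j -` A j \<inter> space M" by metis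
  have "(\<Inter>j\<in>J. B j) = {w\<in>space M. \<forall>i\<in>J. waiting i w \<in> A i}" using A J by auto
  then have "emeasure M (\<Inter>j\<in>J. B j) = (\<Prod>i\<in>J. emeasure gap_pmf (A i))"
    using emeasure_waiting_in_finite[OF J(3)] by simp
  also have "\<dots> = (\<Prod>i\<in>J. emeasure M (B i))"
  proof (rule prod.cong[OF refl])
    fix i assume "i \<in> J"
    then show "emeasure gap_pmf (A i) = emeasure M (B i)"
      unfolding distr_waiting[of i, symmetric] by (simp add: A emeasure_distr)
  qed
  finally show "prob (\<Inter>j\<in>J. B j) = (\<Prod>j\<in>J. prob (B j))"
    by (simp add: emeasure_eq_measure prod_ennreal ennreal_inj prod_nonneg)
qed auto

lemma laplace_waiting:
  assumes "x > 0"
  shows "expectation (\<lambda>w. exp (- x * real (waiting i w))) = (\<Sum>n. exp (- x) ^ n * gap_prob n)"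
proof -
  have exp_eq: "exp (- x * real n) = exp (- x) ^ n" for n :: nat
    by (simp add: exp_of_nat_mult[symmetric] mult.commute)
  have sm: "summable (\<lambda>n. exp (- x) ^ n * gap_prob n)"
    using assms by (intro generating_functions(3)) auto
  have "expectation (\<lambda>w. exp (- x * real (waiting i w))) = measure_pmf.expectation gap_pmf (\<lambda>n. exp (- x * real n))"
    unfolding distr_waiting[of i, symmetric] by (subst integral_distr) auto
  also have "\<dots> = (\<integral>n. pmf gap_pmf n *\<^sub>R exp (- x * real n) \<partial>count_space UNIV)"
    unfolding measure_pmf_eq_density by (subst integral_density) auto
  also have "\<dots> = (\<integral>n. exp (- x) ^ n * gap_prob n \<partial>count_space UNIV)"
    by (simp only: exp_eq pmf_gap_pmf real_scaleR_def mult.commute)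
  also have "\<dots> = (\<Sum>n. exp (- x) ^ n * gap_prob n)"
    using sm gap_prob_nonneg
    by (intro integral_count_space_nat) (simp add: integrable_count_space_nat_iff)
  finally show ?thesis .
qed

text \<open>Since the visit at time 0 has number 0, more than \<open>m\<close> visits by time
  \<open>N\<close> means that visit number \<open>m\<close> has happened by then. Nothing else about
  the local time enters the law of the iterated logarithm.\<close>

lemma less_local_time_iff:
  assumes w: "recurs w"
  shows "m < local_time X a N w \<longleftrightarrow> (\<Sum>i<m. waiting i w) \<le> N"
proof -
  have mono: "strict_mono (\<lambda>i. arrival i w)"
    using arrival_Suc(2)[OF w] by (simp add: strict_mono_Suc_iff del: arrival.simps)
  have ex: "\<exists>i. arrival i w = n" if "X n w = a" for n
  proof -
    obtain i where i: "n < arrival i w"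
      using strict_mono_imp_increasing[OF mono, of "Suc n"] by (meson Suc_le_lessD)
    \<comment> \<open>\<open>n\<close> lies between two consecutive arrivals, the right one
      excluded. The interior of a gap contains no visit, so \<open>n\<close> is the left
      end.\<close>
    define k where "k = (LEAST i. n < arrival i w)"
    have k: "n < arrival k w" unfolding k_def using i by (rule LeastI)
    then have "k \<noteq> 0" by (intro notI) simp
    then obtain k' where k': "k = Suc k'" by (cases k) auto
    then have "arrival k' w \<le> n" using not_less_Least[of k' "\<lambda>i. n < arrival i w"] by (simp add: k_def)
    moreover have "\<not> (arrival k' w < n)"
      using arrival_Suc(3)[OF w, of k'] k that unfolding gap_def k' by blast
    ultimately show ?thesis by (intro exI[of _ k']) linarith
  qed
  have "local_time X a N w = card {r. r \<le> N \<and> X r w = a}"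
    by (simp add: local_time_def of_bool_def sum.If_cases Int_def)
  also have "{r. r \<le> N \<and> X r w = a} = (\<lambda>i. arrival i w) ` {i. arrival i w \<le> N}"
  proof (intro equalityI subsetI)
    fix r assume "r \<in> {r. r \<le> N \<and> X r w = a}"
    then obtain i where "arrival i w = r" "r \<le> N" using ex by blast
    then show "r \<in> (\<lambda>i. arrival i w) ` {i. arrival i w \<le> N}" by blast
  qed (use arrival_Suc(1)[OF w] in blast)
  also have "card \<dots> = card {i. arrival i w \<le> N}"
    using strict_mono_imp_inj_on[OF mono] by (intro card_image) (auto simp: inj_on_def)
  finally have lt: "local_time X a N w = card {i. arrival i w \<le> N}" .
  have "i \<le> N" if "arrival i w \<le> N" for i
    using strict_mono_imp_increasing[OF mono, of i] that by linarith
  then have "{i. arrival i w \<le> N} \<subseteq> {..N}" by blast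
  then have "finite {i. arrival i w \<le> N}" by (rule finite_subset) simp
  moreover have "i \<in> {i. arrival i w \<le> N}" if "i \<le> j" "j \<in> {i. arrival i w \<le> N}" for i j
    using order_trans[OF strict_mono_leD[OF mono that(1)], of N] that(2) by blast
  ultimately have "m < card {i. arrival i w \<le> N} \<longleftrightarrow> m \<in> {i. arrival i w \<le> N}"
    by (rule less_card_down_closed_iff)
  then show ?thesis by (simp add: lt arrival_eq_sum[OF w])
qed

end

section \<open>Law of the iterated logarithm for renewal processes\<close>

text \<open>By independence and 1 - x <= exp (- x), the probability that no event of index in [n, m)
  occurs is at most exp of minus the partial sum. If it stayed positive as m grows, the partial sums
  would be bounded.\<close>

lemma (in prob_space) borel_cantelli_AE2:
  fixes A :: "nat \<Rightarrow> 'a set"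
  assumes indep: "indep_events A UNIV" and div: "\<not> summable (\<lambda>n. prob (A n))"
  shows "AE x in M. \<exists>\<^sub>F n in sequentially. x \<in> A n"
proof -
  have A [measurable]: "A n \<in> events" for n using indep by (auto simp: indep_events_def)
  have indep': "indep_sets (\<lambda>i. sigma_sets (space M) {A i}) UNIV"
    using indep unfolding indep_events_def_alt by (rule indep_sets_sigma) (auto simp: Int_stable_def)
  have "AE x in M. \<not> (\<forall>k\<ge>n. x \<notin> A k)" for n
  proof -
    have le: "prob {x\<in>space M. \<forall>k\<ge>n. x \<notin> A k} \<le> exp (- (\<Sum>k\<in>{n..<m}. prob (A k)))" if "n < m" for m
    proof -
      have "prob {x\<in>space M. \<forall>k\<ge>n. x \<notin> A k} \<le> prob (\<Inter>k\<in>{n..<m}. space M - A k)"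
        using that by (intro finite_measure_mono) auto
      also have "\<dots> = (\<Prod>k\<in>{n..<m}. prob (space M - A k))"
        using that by (intro indep_setsD[OF indep']) (auto intro: sigma_sets.Basic sigma_sets.Compl)
      also have "\<dots> = (\<Prod>k\<in>{n..<m}. 1 - prob (A k))"
        by (intro prod.cong refl prob_compl A)
      also have "\<dots> \<le> (\<Prod>k\<in>{n..<m}. exp (- prob (A k)))"
        using exp_ge_add_one_self[of "- prob (A k)" for k] by (intro prod_mono) auto
      finally show ?thesis by (simp add: exp_sum[symmetric] sum_negf)
    qed
    have "prob {x\<in>space M. \<forall>k\<ge>n. x \<notin> A k} = 0"
    proof (rule ccontr)
      let ?p = "prob {x\<in>space M. \<forall>k\<ge>n. x \<notin> A k}"
      assume "?p \<noteq> 0"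
      then have p: "?p > 0" by (simp add: zero_less_measure_iff)
      have bound: "(\<Sum>k\<in>{n..<m}. prob (A k)) \<le> - ln ?p" if "n < m" for m
      proof -
        have "ln ?p \<le> ln (exp (- (\<Sum>k\<in>{n..<m}. prob (A k))))"
          using le[OF that] p by (subst ln_le_cancel_iff) auto
        then show ?thesis by simp
      qed
      have "summable (\<lambda>k. prob (A (k + n)))"
      proof (rule summableI_nonneg_bounded)
        fix m
        \<comment> \<open>The additional term keeps the index interval nonempty, as
          \<open>bound\<close> requires.\<close>
        have "(\<Sum>k<m. prob (A (k + n))) \<le> (\<Sum>k<Suc m. prob (A (k + n)))" by simp
        also have "\<dots> = (\<Sum>k\<in>{n..<Suc m + n}. prob (A k))"
          using sum.shift_bounds_nat_ivl[of "\<lambda>k. prob (A k)" 0 n "Suc m"] by (simp add: lessThan_atLeast0)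
        also have "\<dots> \<le> - ln ?p" by (rule bound) simp
        finally show "(\<Sum>k<m. prob (A (k + n))) \<le> - ln ?p" .
      qed simp
      with div show False using summable_iff_shift[of "\<lambda>k. prob (A k)" n] by blast
    qed
    then show ?thesis by (subst AE_iff_measurable[OF _ refl]) (auto simp: emeasure_eq_measure)
  qed
  then have "AE x in M. \<forall>n. \<not> (\<forall>k\<ge>n. x \<notin> A k)" by (simp add: AE_all_countable)
  then show ?thesis by (auto simp: frequently_sequentially)
qed

text \<open>That the \<open>T i\<close> are identically distributed is expressed by the common
  transform \<open>\<phi>\<close>. The limit says that 1 - \<phi>(1/x) is asymptotic to 1 /
  (\<kappa> ln x).\<close>

locale renewal_process = prob_space +
  fixes T :: "nat \<Rightarrow> 'a \<Rightarrow> nat" and \<phi> :: "real \<Rightarrow> real" and \<kappa> :: real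
  assumes indep_T: "indep_vars (\<lambda>_. count_space UNIV) T UNIV"
    and laplace_T: "\<And>i t. t > 0 \<Longrightarrow> expectation (\<lambda>w. exp (- t * real (T i w))) = \<phi> t"
    and kappa_pos: "\<kappa> > 0"
    and laplace_asymp: "((\<lambda>x. (1 - \<phi> (1 / x)) * ln x) \<longlongrightarrow> 1 / \<kappa>) at_top"
begin

lemma T_measurable [measurable]: "T i \<in> M \<rightarrow>\<^sub>M count_space UNIV"
  using indep_T by (auto simp: indep_vars_def)

lemma laplace_integrable: "t > 0 \<Longrightarrow> integrable M (\<lambda>w. exp (- t * real (T i w)))"
  by (rule integrable_const_bound[where B = 1]) auto

lemma laplace_bounds:
  assumes "t > 0"
  shows "0 \<le> \<phi> t" "\<phi> t \<le> 1"
proof -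
  have "0 \<le> expectation (\<lambda>w. exp (- t * real (T 0 w)))" by (intro integral_nonneg_AE) auto
  then show "0 \<le> \<phi> t" unfolding laplace_T[OF assms] .
  have "expectation (\<lambda>w. exp (- t * real (T 0 w))) \<le> expectation (\<lambda>_. 1)"
    using assms laplace_integrable[OF assms] by (intro integral_mono) auto
  then show "\<phi> t \<le> 1" unfolding laplace_T[OF assms] by (simp add: prob_space)
qed

text \<open>The indicator of S <= x is at most exp (1 - S / x), whose expectation factorises by
  independence. The factor \<open>exp 1\<close> does not affect summability.\<close>

lemma prob_sum_le:
  assumes x: "x > 0"
  shows "prob {w\<in>space M. real (\<Sum>i<m. T i w) \<le> x} \<le> exp 1 * \<phi> (1 / x) ^ m"
proof -
  define E where "E i w = exp (- (1 / x) * real (T i w))" for i w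
  have "indep_vars (\<lambda>_. borel) (\<lambda>i w. exp (- (1 / x) * real (T i w))) {..<m}"
    by (rule indep_vars_compose2[OF indep_vars_subset[OF indep_T]]) auto
  then have indep_E: "indep_vars (\<lambda>_. borel) E {..<m}" by (simp add: E_def[abs_def])
  have int_E: "integrable M (E i)" for i
    unfolding E_def[abs_def] using x by (intro laplace_integrable) auto
  have "prob {w\<in>space M. real (\<Sum>i<m. T i w) \<le> x}
      = expectation (indicator {w\<in>space M. real (\<Sum>i<m. T i w) \<le> x})" by simp
  also have "\<dots> \<le> expectation (\<lambda>w. exp 1 * (\<Prod>i<m. E i w))"
  proof (rule integral_mono)
    show "integrable M (indicator {w\<in>space M. real (\<Sum>i<m. T i w) \<le> x} :: _ \<Rightarrow> real)"
      by (intro integrable_real_indicator) (measurable, simp add: emeasure_eq_measure)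
    show "integrable M (\<lambda>w. exp 1 * (\<Prod>i<m. E i w))"
      by (intro integrable_mult_right indep_vars_integrable indep_E int_E) auto
    show "indicator {w\<in>space M. real (\<Sum>i<m. T i w) \<le> x} w \<le> exp 1 * (\<Prod>i<m. E i w)" for w
    proof -
      have "exp 1 * (\<Prod>i<m. E i w) = exp (1 - (1 / x) * real (\<Sum>i<m. T i w))"
        by (simp add: E_def exp_sum[symmetric] exp_add[symmetric] sum_negf sum_divide_distrib)
      also have "\<dots> \<ge> indicator {w\<in>space M. real (\<Sum>i<m. T i w) \<le> x} w"
        using x by (auto simp: indicator_def)
      finally show ?thesis .
    qed
  qed
  also have "\<dots> = exp 1 * (\<Prod>i<m. expectation (E i))"
    by (simp add: indep_vars_lebesgue_integral[OF _ indep_E int_E])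
  also have "(\<Prod>i<m. expectation (E i)) = \<phi> (1 / x) ^ m"
    using x laplace_T[of "1 / x"] by (simp add: E_def[abs_def])
  finally show ?thesis .
qed

text \<open>Markov's inequality for 1 - exp (- t T), which exceeds 1 - exp (- t y) when T > y. It is
  sharp enough when t y is large.\<close>

lemma prob_T_gt_le:
  assumes t: "t > 0" and y: "y > 0"
  shows "prob {w\<in>space M. real (T i w) > y} \<le> (1 - \<phi> t) / (1 - exp (- t * y))"
proof -
  have pos: "1 - exp (- t * y) > 0" using t y by simp
  have "(1 - exp (- t * y)) * prob {w\<in>space M. real (T i w) > y}
      = expectation (\<lambda>w. (1 - exp (- t * y)) * indicator {w\<in>space M. real (T i w) > y} w)" by simp
  also have "\<dots> \<le> expectation (\<lambda>w. 1 - exp (- t * real (T i w)))"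
  proof (rule integral_mono)
    show "integrable M (\<lambda>w. (1 - exp (- t * y)) * indicator {w\<in>space M. real (T i w) > y} w)"
      by (intro integrable_mult_right integrable_real_indicator) (measurable, simp add: emeasure_eq_measure)
    show "integrable M (\<lambda>w. 1 - exp (- t * real (T i w)))"
      using laplace_integrable[OF t] by (intro Bochner_Integration.integrable_diff) auto
    show "(1 - exp (- t * y)) * indicator {w\<in>space M. real (T i w) > y} w \<le> 1 - exp (- t * real (T i w))" for w
      using t by (auto simp: indicator_def)
  qed
  also have "\<dots> = 1 - \<phi> t"
    by (subst Bochner_Integration.integral_diff[OF _ laplace_integrable[OF t]])
       (simp_all only: laplace_T[OF t], simp_all add: prob_space)
  finally show ?thesis using pos by (simp add: pos_le_divide_eq mult.commute)
qed

section \<open>Almost sure upper and lower bounds\<close>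

lemma upper_AE:
  assumes d: "d > 1" and r: "r > 1"
  shows "AE w in M. \<forall>\<^sub>F k in sequentially.
    exp (r ^ k) < real (\<Sum>i<nat \<lceil>d * \<kappa> * r ^ k * ln (real k * ln r)\<rceil>. T i w)"
proof -
  define m where "m k = nat \<lceil>d * \<kappa> * r ^ k * ln (real k * ln r)\<rceil>" for k
  \<comment> \<open>Of \<open>d = q * q\<close>, one factor absorbs the error in the asymptotics of
    \<open>\<phi>\<close>; the other is the exponent in the summable bound by k powr (- q).\<close>
  define q where "q = sqrt d"
  have q: "q > 1" "q * q = d" using d by (auto simp: q_def)
  define A where "A k = {w\<in>space M. real (\<Sum>i<m k. T i w) \<le> exp (r ^ k)}" for k
  have A [measurable]: "A k \<in> events" for k unfolding A_def by measurable
  have "((\<lambda>k. (1 - \<phi> (1 / exp (r ^ k))) * ln (exp (r ^ k))) \<longlongrightarrow> 1 / \<kappa>) sequentially"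
    using r by (intro filterlim_compose[OF laplace_asymp]) real_asymp
  moreover have "1 / (\<kappa> * q) < 1 / \<kappa>" using q kappa_pos by (simp add: field_simps)
  ultimately have ev1: "\<forall>\<^sub>F k in sequentially. 1 / (\<kappa> * q) < (1 - \<phi> (1 / exp (r ^ k))) * r ^ k"
    by (auto dest: order_tendstoD)
  have "filterlim (\<lambda>k. ln (real k * ln r)) at_top sequentially"
    using r by real_asymp
  then have ev2: "\<forall>\<^sub>F k in sequentially. ln (real k * ln r) \<ge> 0"
    by (auto simp: filterlim_at_top)
  have ev: "\<forall>\<^sub>F k in sequentially. norm (prob (A k)) \<le> exp 1 * (ln r) powr (- q) * real k powr (- q)"
    using ev1 ev2 eventually_gt_at_top[of 0]
  proof eventually_elim
    case (elim k)
    define p where "p = \<phi> (1 / exp (r ^ k))"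
    define L where "L = ln (real k * ln r)"
    have p: "0 \<le> p" "p \<le> 1" unfolding p_def by (intro laplace_bounds; simp)+
    have "q * L = 1 / (\<kappa> * q) * (q * q * \<kappa> * L)" using q(1) kappa_pos by simp
    then have "q * L = 1 / (\<kappa> * q) * (d * \<kappa> * L)" using q by simp
    also have "\<dots> \<le> ((1 - p) * r ^ k) * (d * \<kappa> * L)"
      using elim d kappa_pos by (intro mult_right_mono) (auto simp: p_def L_def)
    also have "\<dots> = (1 - p) * (d * \<kappa> * r ^ k * L)" by simp
    also have "\<dots> \<le> (1 - p) * real (m k)"
      using p unfolding m_def L_def by (intro mult_left_mono) linarith+
    finally have *: "q * L \<le> (1 - p) * real (m k)" .
    have "p ^ m k \<le> exp (- (1 - p)) ^ m k"
      using p exp_ge_add_one_self[of "- (1 - p)"] by (intro power_mono) auto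
    also have "\<dots> = exp (- ((1 - p) * real (m k)))" by (simp flip: exp_of_nat_mult add: algebra_simps)
    also have "\<dots> \<le> exp (- (q * L))" using * by simp
    also have "\<dots> = (real k * ln r) powr (- q)"
      using elim r by (simp add: L_def powr_def)
    also have "\<dots> = (ln r) powr (- q) * real k powr (- q)"
      using r by (simp add: powr_mult)
    finally have "exp 1 * p ^ m k \<le> exp 1 * ((ln r) powr (- q) * real k powr (- q))"
      by simp
    moreover have "prob (A k) \<le> exp 1 * p ^ m k"
      unfolding A_def p_def by (rule prob_sum_le) simp
    ultimately have "prob (A k) \<le> exp 1 * ((ln r) powr (- q) * real k powr (- q))" by linarith
    then show ?case by (simp add: mult.assoc)
  qed
  have "summable (\<lambda>k. exp 1 * (ln r) powr (- q) * real k powr (- q))"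
    using q by (intro summable_mult) (simp add: summable_real_powr_iff)
  then have "summable (\<lambda>k. prob (A k))"
    by (rule summable_comparison_test_ev[OF ev])
  then have "AE w in M. \<forall>\<^sub>F k in sequentially. w \<in> space M - A k"
    by (intro borel_cantelli_AE1) (auto simp: emeasure_eq_measure)
  then show ?thesis
    by (rule AE_mp) (auto intro!: AE_I2 elim!: eventually_mono simp: A_def m_def not_le)
qed

text \<open>Interpolation between the times exp (r ^ k): \<open>K N\<close> is eventually the k with
  r ^ k <= ln N < r ^ Suc k. Moving to the right end costs the factor \<open>r\<close>; the second
  factor \<open>d\<close> pays for rounding and for the ratio of the triple logarithms.
  \<open>\<xi>\<close> is quantified inside the almost sure statement because it will be the local
  time along the path \<open>w\<close>.\<close>

lemma limsup_le_AE:
  assumes d: "d > 1" and r: "r > 1"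
  shows "AE w in M. \<forall>\<xi>::nat \<Rightarrow> nat. (\<forall>m N. m < \<xi> N \<longleftrightarrow> (\<Sum>i<m. T i w) \<le> N) \<longrightarrow>
    limsup (\<lambda>N. ereal (real (\<xi> N) / (ln (real N) * ln (ln (ln (real N)))))) \<le> ereal (d\<^sup>2 * \<kappa> * r)"
  using upper_AE[OF d r]
proof (rule AE_mp, intro AE_I2 impI allI)
  fix w and \<xi> :: "nat \<Rightarrow> nat"
  assume up: "\<forall>\<^sub>F k in sequentially.
    exp (r ^ k) < real (\<Sum>i<nat \<lceil>d * \<kappa> * r ^ k * ln (real k * ln r)\<rceil>. T i w)"
    and xi: "\<forall>m N. m < \<xi> N \<longleftrightarrow> (\<Sum>i<m. T i w) \<le> N"
  define a where "a = ln r"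
  have a: "a > 0" using r by (simp add: a_def)
  \<comment> \<open>The later bound on \<open>\<xi> N\<close> divided by
    \<open>r ^ k * ln (real k * a)\<close>; the rounding term 1 has been replaced by
    \<open>r ^ k\<close>.\<close>
  have "((\<lambda>k. (d * \<kappa> * r * ln ((real k + 1) * a) / ln (real k * a)) + 1 / ln (real k * a)) \<longlongrightarrow> d * \<kappa> * r) sequentially"
    using d r kappa_pos a by real_asymp
  moreover have "d * \<kappa> * r < d\<^sup>2 * \<kappa> * r" using d r kappa_pos by (simp add: power2_eq_square)
  ultimately have ev1: "\<forall>\<^sub>F k in sequentially.
      d * \<kappa> * r * ln ((real k + 1) * a) / ln (real k * a) + 1 / ln (real k * a) < d\<^sup>2 * \<kappa> * r"
    by (rule order_tendstoD)
  have "filterlim (\<lambda>k. ln (real k * a)) at_top sequentially" using a by real_asymp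
  then have ev2: "\<forall>\<^sub>F k in sequentially. ln (real k * a) > 0"
    unfolding filterlim_at_top_dense by auto
  have up': "\<forall>\<^sub>F k in sequentially. exp (r ^ Suc k) <
      real (\<Sum>i<nat \<lceil>d * \<kappa> * r ^ Suc k * ln (real (Suc k) * a)\<rceil>. T i w)"
    using up by (subst eventually_sequentially_Suc) (simp add: a_def)
  define K where "K N = nat \<lfloor>log r (ln (real N))\<rfloor>" for N :: nat
  have K: "filterlim K sequentially sequentially"
  proof -
    have "filterlim (\<lambda>N::nat. log r (ln (real N))) at_top sequentially"
      unfolding log_def using r by real_asymp
    then show ?thesis unfolding K_def
      by (intro filterlim_compose[OF filterlim_nat_sequentially] filterlim_compose[OF filterlim_floor_sequentially])
  qed
  have "\<forall>\<^sub>F k in sequentially. ln (real k * a) > 0 \<and> k > 0 \<and>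
     d * \<kappa> * r * ln ((real k + 1) * a) / ln (real k * a) + 1 / ln (real k * a) < d\<^sup>2 * \<kappa> * r \<and>
     exp (r ^ Suc k) < real (\<Sum>i<nat \<lceil>d * \<kappa> * r ^ Suc k * ln (real (Suc k) * a)\<rceil>. T i w)"
    using ev1 ev2 up' eventually_gt_at_top[of 0] by eventually_elim simp
  from eventually_compose_filterlim[OF this K] eventually_ge_at_top[of 16]
  have "\<forall>\<^sub>F N in sequentially. real (\<xi> N) / (ln (real N) * ln (ln (ln (real N)))) \<le> d\<^sup>2 * \<kappa> * r"
  proof eventually_elim
    case (elim N)
    define k where "k = K N"
    define L where "L = ln (real k * a)"
    define L' where "L' = ln ((real k + 1) * a)"
    note e = elim(1)[folded k_def]
    have L: "L > 0" using e by (simp add: L_def)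
    have lnN: "ln (real N) > 1"
    proof -
      have "ln (exp 1) < ln (real N)"
        using elim(2) e_less_272 by (subst ln_less_cancel_iff) auto
      then show ?thesis by simp
    qed
    have "log r (ln (real N)) > 0" using lnN r by simp
    then have k: "real k \<le> log r (ln (real N))" "log r (ln (real N)) < real k + 1"
      unfolding k_def K_def by linarith+
    have "r powr real k \<le> r powr log r (ln (real N))" using k r by (intro powr_mono) auto
    then have lo: "r ^ k \<le> ln (real N)" using lnN r by (simp add: powr_realpow)
    have "r powr log r (ln (real N)) < r powr (real k + 1)" using k r by (intro powr_less_mono) auto
    also have "r powr (real k + 1) = r ^ Suc k" using r by (simp add: powr_add powr_realpow)
    finally have hi: "ln (real N) < r ^ Suc k" using lnN r by simp
    have "real N = exp (ln (real N))" using elim(2) by simp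
    also have "\<dots> < exp (r ^ Suc k)" using hi by simp
    also have "\<dots> < real (\<Sum>i<nat \<lceil>d * \<kappa> * r ^ Suc k * ln (real (Suc k) * a)\<rceil>. T i w)"
      using e by blast
    finally have "\<not> (\<Sum>i<nat \<lceil>d * \<kappa> * r ^ Suc k * ln (real (Suc k) * a)\<rceil>. T i w) \<le> N"
      by (simp del: of_nat_sum)
    then have "\<xi> N \<le> nat \<lceil>d * \<kappa> * r ^ Suc k * ln (real (Suc k) * a)\<rceil>"
      using xi not_less by blast
    then have "real (\<xi> N) \<le> d * \<kappa> * r ^ Suc k * L' + 1"
    proof -
      have "0 \<le> L'" using L a e unfolding L_def L'_def
        by (intro order.trans[OF less_imp_le[OF L[unfolded L_def]] ln_mono]) auto
      then have "0 \<le> d * \<kappa> * r ^ Suc k * L'" using d kappa_pos r by simp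
      moreover have "L' = ln (real (Suc k) * a)" by (simp add: L'_def add.commute)
      ultimately show ?thesis
        using \<open>\<xi> N \<le> _\<close> by (simp only:) linarith
    qed
    also have "\<dots> \<le> d * \<kappa> * r ^ Suc k * L' + r ^ k" using r by simp
    also have "\<dots> = (r ^ k * L) * (d * \<kappa> * r * L' / L + 1 / L)" using L by (simp add: field_simps)
    also have "\<dots> \<le> (r ^ k * L) * (d\<^sup>2 * \<kappa> * r)"
      using e L r by (intro mult_left_mono) (auto simp: L_def L'_def)
    also have "\<dots> \<le> (ln (real N) * ln (ln (ln (real N)))) * (d\<^sup>2 * \<kappa> * r)"
    proof -
      have ka: "real k * a > 0" using e a by simp
      have "real k * a = ln (r ^ k)" using r by (simp add: a_def ln_realpow)
      also have "\<dots> \<le> ln (ln (real N))" using lo r lnN by (subst ln_le_cancel_iff) auto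
      finally have "L \<le> ln (ln (ln (real N)))" unfolding L_def using ka by (subst ln_le_cancel_iff) auto
      then show ?thesis using lo L r d kappa_pos lnN by (intro mult_right_mono mult_mono) auto
    qed
    finally have *: "real (\<xi> N) \<le> (ln (real N) * ln (ln (ln (real N)))) * (d\<^sup>2 * \<kappa> * r)" .
    have "ln (real N) * ln (ln (ln (real N))) > 0"
    proof -
      have "real k * a = ln (r ^ k)" using r by (simp add: a_def ln_realpow)
      also have "\<dots> \<le> ln (ln (real N))" using lo r lnN by (subst ln_le_cancel_iff) auto
      finally have "L \<le> ln (ln (ln (real N)))" unfolding L_def using e a by (subst ln_le_cancel_iff) auto
      then show ?thesis using L lnN by (intro mult_pos_pos) linarith+
    qed
    then show ?case using * by (simp add: pos_divide_le_eq mult.commute)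
  qed
  then show "limsup (\<lambda>N. ereal (real (\<xi> N) / (ln (real N) * ln (ln (ln (real N)))))) \<le> ereal (d\<^sup>2 * \<kappa> * r)"
    by (intro Limsup_bounded) (auto elim: eventually_mono)
qed

text \<open>
  The exponent \<open>1 / \<beta>\<^sup>2 > 1\<close> makes \<open>l (k - 1) / l k\<close> summable, while the probability that the
  \<open>k\<close>-th block of waiting times is good still is at least of order \<open>1 / k\<close>.
\<close>
lemma lower_AE:
  fixes \<beta> :: real
  assumes \<beta>: "0 < \<beta>" "\<beta> < 1"
  defines "p \<equiv> 1 / \<beta>\<^sup>2"
  defines "l \<equiv> \<lambda>k. exp (real (Suc k) powr p)"
  shows "AE w in M. \<exists>\<^sub>F k in sequentially.
    real (\<Sum>i<nat \<lfloor>\<beta>\<^sup>2 * \<kappa> * l k * ln (real (Suc k))\<rfloor>. T i w) \<le> exp (l k)"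
proof -
  define m where "m k = nat \<lfloor>\<beta>\<^sup>2 * \<kappa> * l k * ln (real (Suc k))\<rfloor>" for k
  \<comment> \<open>\<open>m k \<le> (l k)\<^sup>2\<close> eventually, so \<open>m k\<close> waiting times below \<open>y k\<close> add up to at most \<open>exp (l k)\<close>.\<close>
  define y where "y k = exp (l k) / (l k)\<^sup>2" for k
  \<comment> \<open>The asymptotic tail 1 / (\<kappa> l k) enlarged by 1/\<beta>, so that it
    dominates the true tail eventually.\<close>
  define Q where "Q k = 1 / (\<beta> * \<kappa> * l k)" for k
  \<comment> \<open>\<open>B k\<close> is a failure before block \<open>k\<close>, measured by the
    threshold of that block, and has summable probability. \<open>A k\<close> is success within
    block \<open>k\<close>; these events are independent since the blocks are disjoint.\<close>
  define B where "B k = {w\<in>space M. \<exists>i\<in>{..<m k}. real (T i w) > y (Suc k)}" for k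
  define A where "A k = {w\<in>space M. \<forall>i\<in>{m k..<m (Suc k)}. real (T i w) \<le> y (Suc k)}" for k
  have [measurable]: "A k \<in> events" "B k \<in> events" for k unfolding A_def B_def by measurable
  have p: "p > 1" using \<beta> unfolding p_def by (simp add: power_less_one_iff)
  have l_pos: "l k > 0" for k by (simp add: l_def)
  have y_pos: "y k > 0" for k using l_pos[of k] by (simp add: y_def)
  have m_le: "real (m k) \<le> \<beta>\<^sup>2 * \<kappa> * l k * ln (real (Suc k))" for k
    unfolding m_def using \<beta> kappa_pos l_pos[of k] by simp
  have l_mono: "l k \<le> l (Suc k)" for k
    unfolding l_def using p by (simp add: powr_mono2)
  have m_mono: "mono m"
  proof (rule incseq_SucI)
    fix k
    have "l k * ln (real (Suc k)) \<le> l (Suc k) * ln (real (Suc (Suc k)))"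
      using l_mono[of k] l_pos[of "Suc k"] by (intro mult_mono) auto
    then have "\<beta>\<^sup>2 * \<kappa> * (l k * ln (real (Suc k))) \<le> \<beta>\<^sup>2 * \<kappa> * (l (Suc k) * ln (real (Suc (Suc k))))"
      using kappa_pos by (intro mult_left_mono) auto
    then show "m k \<le> m (Suc k)"
      unfolding m_def mult.assoc by (intro nat_mono floor_mono)
  qed
  have l_top: "filterlim l at_top sequentially" unfolding l_def using p by real_asymp
  have prob_gt: "\<forall>\<^sub>F k in sequentially. \<forall>i. prob {w\<in>space M. real (T i w) > y k} \<le> Q k"
  proof -
    \<comment> \<open>With threshold exp u / u^2 the ratio threshold / \<open>x u\<close> is u, so
      the denominator 1 - exp (- u) tends to 1, while ln (x u) is still asymptotic to u.\<close>
    define x where "x u = exp u / u ^ 3" for u :: real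
    have "((\<lambda>u. (1 - \<phi> (1 / x u)) * ln (x u)) \<longlongrightarrow> 1 / \<kappa>) at_top"
      unfolding x_def by (intro filterlim_compose[OF laplace_asymp]) real_asymp
    moreover have "((\<lambda>u::real. u / (u - 3 * ln u) / (1 - exp (- u))) \<longlongrightarrow> 1) at_top" by real_asymp
    ultimately have "((\<lambda>u. ((1 - \<phi> (1 / x u)) * ln (x u)) * (u / (u - 3 * ln u) / (1 - exp (- u))))
        \<longlongrightarrow> 1 / \<kappa> * 1) at_top" by (rule tendsto_mult)
    moreover have "1 / \<kappa> * 1 < 1 / (\<beta> * \<kappa>)" using \<beta> kappa_pos by (simp add: field_simps)
    ultimately have "\<forall>\<^sub>F u in at_top. ((1 - \<phi> (1 / x u)) * ln (x u)) * (u / (u - 3 * ln u) / (1 - exp (- u)))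
        < 1 / (\<beta> * \<kappa>)" by (rule order_tendstoD)
    moreover have "\<forall>\<^sub>F u::real in at_top. u - 3 * ln u > 0" by real_asymp
    ultimately have "\<forall>\<^sub>F u in at_top. u > 0 \<and> (1 - \<phi> (1 / x u)) / (1 - exp (- u)) < 1 / (\<beta> * \<kappa> * u)"
      using eventually_gt_at_top[of 0]
    proof eventually_elim
      case (elim u)
      have "ln (x u) = u - 3 * ln u"
        using elim by (simp add: x_def ln_div ln_realpow)
      with elim have "(1 - \<phi> (1 / x u)) / (1 - exp (- u)) * u < 1 / (\<beta> * \<kappa>)" by simp
      then have "(1 - \<phi> (1 / x u)) / (1 - exp (- u)) < 1 / (\<beta> * \<kappa>) / u"
        using elim by (simp only: pos_less_divide_eq)
      then show ?case using elim by simp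
    qed
    from eventually_compose_filterlim[OF this l_top]
    show ?thesis
    proof eventually_elim
      case (elim k)
      show ?case
      proof
        fix i
        have "prob {w\<in>space M. real (T i w) > y k}
            \<le> (1 - \<phi> (1 / x (l k))) / (1 - exp (- (1 / x (l k)) * y k))"
          using elim y_pos[of k] by (intro prob_T_gt_le) (auto simp: x_def)
        also have "- (1 / x (l k)) * y k = - l k"
          using elim by (simp add: x_def y_def power2_eq_square power3_eq_cube)
        finally show "prob {w\<in>space M. real (T i w) > y k} \<le> Q k"
          using elim unfolding Q_def by linarith
      qed
    qed
  qed
  then have prob_gt': "\<forall>\<^sub>F k in sequentially. \<forall>i. prob {w\<in>space M. real (T i w) > y (Suc k)} \<le> Q (Suc k)"
    by (subst eventually_sequentially_Suc)

  have "AE w in M. \<forall>\<^sub>F k in sequentially. w \<in> space M - B k"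
  proof (rule borel_cantelli_AE1)
    have "((\<lambda>k. ln (real (Suc k)) * exp (- (real (Suc k) powr (p - 1))) * real k powr 2) \<longlongrightarrow> 0) sequentially"
      using p by real_asymp
    then have "\<forall>\<^sub>F k in sequentially. ln (real (Suc k)) * exp (- (real (Suc k) powr (p - 1))) * real k powr 2 < 1"
      by (rule order_tendstoD) simp
    then have "\<forall>\<^sub>F k in sequentially. norm (prob (B k)) \<le> real k powr (- 2)"
      using prob_gt' eventually_gt_at_top[of 0]
    proof eventually_elim
      case (elim k)
      have "B k = (\<Union>i\<in>{..<m k}. {w\<in>space M. real (T i w) > y (Suc k)})" by (auto simp: B_def)
      then have "prob (B k) \<le> (\<Sum>i<m k. prob {w\<in>space M. real (T i w) > y (Suc k)})"
        by (simp only:) (intro finite_measure_subadditive_finite, auto)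
      also have "\<dots> \<le> (\<Sum>i<m k. Q (Suc k))" using elim by (intro sum_mono) auto
      also have "\<dots> = real (m k) * Q (Suc k)" by simp
      also have "\<dots> \<le> (\<beta>\<^sup>2 * \<kappa> * l k * ln (real (Suc k))) * Q (Suc k)"
        using m_le \<beta> kappa_pos l_pos by (intro mult_right_mono) (auto simp: Q_def less_imp_le)
      also have "\<dots> = \<beta> * (ln (real (Suc k)) * (l k / l (Suc k)))"
        using \<beta> kappa_pos l_pos[of "Suc k"] by (simp add: Q_def power2_eq_square)
      also have "\<dots> \<le> 1 * (ln (real (Suc k)) * (l k / l (Suc k)))"
        using \<beta> l_pos by (intro mult_right_mono) (auto simp: less_imp_le)
      also have "l k / l (Suc k) = exp (real (Suc k) powr p - real (Suc (Suc k)) powr p)"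
        by (simp add: l_def exp_diff)
      also have "1 * (ln (real (Suc k)) * exp (real (Suc k) powr p - real (Suc (Suc k)) powr p))
          \<le> ln (real (Suc k)) * exp (- (real (Suc k) powr (p - 1)))"
      proof -
        \<comment> \<open>Splitting off one factor gives (k+2)^p - (k+1)^p >= (k+1)^(p-1). As p > 1,
          this grows like a positive power of k, which beats the factor ln (k+1).\<close>
        have eq: "real (Suc n) powr p = real (Suc n) * real (Suc n) powr (p - 1)" for n
          by (simp add: powr_diff)
        have "real (Suc k) powr (p - 1) \<le> real (Suc (Suc k)) powr (p - 1)"
          using p by (intro powr_mono2) auto
        then have "real (Suc k) powr p \<le> real (Suc k) * real (Suc (Suc k)) powr (p - 1)"
          unfolding eq by (intro mult_left_mono) auto
        moreover have "real (Suc (Suc k)) powr p =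
            real (Suc k) * real (Suc (Suc k)) powr (p - 1) + real (Suc (Suc k)) powr (p - 1)"
          unfolding eq[of "Suc k"] by (simp add: algebra_simps)
        ultimately have "real (Suc k) powr p - real (Suc (Suc k)) powr p \<le> - (real (Suc k) powr (p - 1))"
          using \<open>real (Suc k) powr (p - 1) \<le> _\<close> by linarith
        then show ?thesis unfolding mult_1 by (intro mult_left_mono) auto
      qed
      also have "\<dots> \<le> real k powr (- 2)"
        using elim by (simp add: powr_minus field_simps)
      finally show ?case by simp
    qed
    then show "summable (\<lambda>k. prob (B k))"
      by (rule summable_comparison_test_ev) (simp add: summable_real_powr_iff)
  qed (auto simp: emeasure_eq_measure)
  moreover have "AE w in M. \<exists>\<^sub>F k in sequentially. w \<in> A k"
  proof (rule borel_cantelli_AE2)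
    define I where "I k = {m k..<m (Suc k)}" for k
    have disj: "disjoint_family_on I UNIV"
      unfolding I_def disjoint_family_on_def
    proof (intro ballI impI)
      fix j k :: nat assume "j \<noteq> k"
      then have "m (Suc j) \<le> m k \<or> m (Suc k) \<le> m j"
        using monoD[OF m_mono, of "Suc j" k] monoD[OF m_mono, of "Suc k" j] by linarith
      then show "{m j..<m (Suc j)} \<inter> {m k..<m (Suc k)} = {}" by auto
    qed
    have "indep_vars (\<lambda>k. PiM (I k) (\<lambda>_. count_space UNIV)) (\<lambda>k w. restrict (\<lambda>i. T i w) (I k)) UNIV"
      by (rule indep_vars_restrict[OF indep_T _ disj]) auto
    then have "indep_events (\<lambda>k. {w\<in>space M. \<forall>i\<in>I k. real (restrict (\<lambda>i. T i w) (I k) i) \<le> y (Suc k)}) UNIV"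
    proof (rule indep_eventsI_indep_vars)
      fix k
      have "finite (I k)" by (simp add: I_def)
      then show "{f \<in> space (PiM (I k) (\<lambda>_. count_space UNIV)). \<forall>i\<in>I k. real (f i) \<le> y (Suc k)}
          \<in> sets (PiM (I k) (\<lambda>_. count_space (UNIV :: nat set)))"
        by measurable
    qed
    moreover have "(\<lambda>k. {w\<in>space M. \<forall>i\<in>I k. real (restrict (\<lambda>i. T i w) (I k) i) \<le> y (Suc k)}) = A"
      by (auto simp: A_def[abs_def] I_def fun_eq_iff)
    ultimately show "indep_events A UNIV" by simp
    have Q_lim: "Q \<longlonglongrightarrow> 0"
      unfolding Q_def l_def using \<beta> kappa_pos p by real_asymp
    then have "\<forall>\<^sub>F k in sequentially. Q k < 1 - \<beta>" using \<beta> by (intro order_tendstoD) auto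
    then have "\<forall>\<^sub>F k in sequentially. Q (Suc k) < 1 - \<beta>" by (subst eventually_sequentially_Suc)
    then have ev: "\<forall>\<^sub>F k in sequentially. norm (1 / (real k + 2)) \<le> prob (A k)"
      using prob_gt'
    proof eventually_elim
      case (elim k)
      let ?q = "Q (Suc k)"
      have q: "0 < ?q" "?q < 1 - \<beta>" using elim \<beta> kappa_pos l_pos by (auto simp: Q_def)
      have ge: "1 - ?q \<le> prob {w\<in>space M. real (T i w) \<le> y (Suc k)}" for i
      proof -
        have "prob {w\<in>space M. real (T i w) > y (Suc k)} =
            1 - prob {w\<in>space M. real (T i w) \<le> y (Suc k)}"
          by (subst prob_neg[symmetric]) (auto simp: not_le)
        moreover have "prob {w\<in>space M. real (T i w) > y (Suc k)} \<le> ?q" using elim by blast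
        ultimately show ?thesis by linarith
      qed
      have prod: "prob (A k) = (\<Prod>i\<in>I k. prob {w\<in>space M. real (T i w) \<le> y (Suc k)})"
      proof (cases "I k = {}")
        case True
        then show ?thesis by (simp add: A_def I_def prob_space)
      next
        case False
        have "A k = (\<Inter>i\<in>I k. T i -` {n. real n \<le> y (Suc k)} \<inter> space M)"
          using False by (auto simp: A_def I_def)
        also have "prob \<dots> = (\<Prod>i\<in>I k. prob (T i -` {n. real n \<le> y (Suc k)} \<inter> space M))"
          using False by (intro indep_varsD[OF indep_T]) (auto simp: I_def)
        also have "\<dots> = (\<Prod>i\<in>I k. prob {w\<in>space M. real (T i w) \<le> y (Suc k)})"
          by (intro prod.cong refl arg_cong[where f = prob]) auto
        finally show ?thesis .
      qed
      \<comment> \<open>The two factors \<beta> in \<open>m\<close> pay for the 1/\<beta> in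
        \<open>Q\<close> and for the 1/\<beta> here, leaving a total exponent of at most
        \<open>ln (real k + 2)\<close>.\<close>
      have "exp (- (?q / \<beta>)) \<le> 1 - ?q"
      proof -
        have "?q / (1 - ?q) \<le> ?q / \<beta>" using q \<beta> by (intro divide_left_mono mult_pos_pos) auto
        moreover have "1 + ?q / (1 - ?q) = 1 / (1 - ?q)" using q \<beta> by (simp add: field_simps)
        ultimately have "1 / (1 - ?q) \<le> exp (?q / \<beta>)"
          using exp_ge_add_one_self[of "?q / \<beta>"] by linarith
        then have "1 \<le> exp (?q / \<beta>) * (1 - ?q)" using q \<beta> by (simp add: pos_divide_le_eq)
        then show ?thesis by (simp add: exp_minus field_simps)
      qed
      have "1 / (real k + 2) = exp (- ln (real k + 2))" by (simp add: exp_minus field_simps)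
      also have "\<dots> \<le> exp (- (real (m (Suc k)) * (?q / \<beta>)))"
      proof -
        have "real (m (Suc k)) * (?q / \<beta>) \<le> (\<beta>\<^sup>2 * \<kappa> * l (Suc k) * ln (real (Suc (Suc k)))) * (?q / \<beta>)"
          using q \<beta> by (intro mult_right_mono m_le) auto
        also have "\<dots> = ln (real k + 2)"
          using \<beta> kappa_pos l_pos[of "Suc k"] by (simp add: Q_def power2_eq_square add.commute)
        finally show ?thesis by simp
      qed
      also have "\<dots> = exp (- (?q / \<beta>)) ^ m (Suc k)" by (simp flip: exp_of_nat_mult)
      also have "\<dots> \<le> exp (- (?q / \<beta>)) ^ card (I k)"
        using q \<beta> by (intro power_decreasing) (auto simp: I_def)
      also have "\<dots> \<le> (1 - ?q) ^ card (I k)"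
        using \<open>exp (- (?q / \<beta>)) \<le> 1 - ?q\<close> by (intro power_mono) auto
      also have "\<dots> = (\<Prod>i\<in>I k. 1 - ?q)" by simp
      also have "\<dots> \<le> prob (A k)" unfolding prod using ge q \<beta> by (intro prod_mono) auto
      finally show ?case by simp
    qed
    show "\<not> summable (\<lambda>k. prob (A k))"
    proof
      assume "summable (\<lambda>k. prob (A k))"
      then have "summable (\<lambda>k. 1 / (real k + 2))" by (rule summable_comparison_test_ev[OF ev])
      then have "summable (\<lambda>k. 1 / real (k + 2))" by (simp add: add.commute)
      then have "summable (\<lambda>k. 1 / real k)" by (subst (asm) summable_iff_shift)
      then show False using not_summable_harmonic[where 'a = real] by (simp add: inverse_eq_divide)
    qed
  qed
  ultimately have "AE w in M. \<exists>\<^sub>F k in sequentially.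
    real (\<Sum>i<m (Suc k). T i w) \<le> exp (l (Suc k))"
  proof (rule AE_mp[OF AE_conjI], intro AE_I2 impI)
    fix w assume w: "(\<forall>\<^sub>F k in sequentially. w \<in> space M - B k) \<and> (\<exists>\<^sub>F k in sequentially. w \<in> A k)"
    have "\<forall>\<^sub>F k in sequentially. \<beta>\<^sup>2 * \<kappa> * ln (real (Suc (Suc k))) \<le> l (Suc k)"
      unfolding l_def using p \<beta> kappa_pos by real_asymp
    then have "\<forall>\<^sub>F k in sequentially. real (m (Suc k)) * y (Suc k) \<le> exp (l (Suc k))"
    proof eventually_elim
      case (elim k)
      have "real (m (Suc k)) \<le> \<beta>\<^sup>2 * \<kappa> * ln (real (Suc (Suc k))) * l (Suc k)"
        using m_le[of "Suc k"] by (simp add: mult_ac)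
      also have "\<dots> \<le> l (Suc k) * l (Suc k)" using elim l_pos by (intro mult_right_mono) (auto simp: less_imp_le)
      finally have "real (m (Suc k)) * y (Suc k) \<le> (l (Suc k) * l (Suc k)) * y (Suc k)"
        using y_pos by (intro mult_right_mono) (auto simp: less_imp_le)
      also have "\<dots> = exp (l (Suc k))" using l_pos[of "Suc k"] by (simp add: y_def power2_eq_square)
      finally show ?case .
    qed
    with conjunct1[OF w] have "\<forall>\<^sub>F k in sequentially.
        w \<in> A k \<longrightarrow> real (\<Sum>i<m (Suc k). T i w) \<le> exp (l (Suc k))"
    proof eventually_elim
      case (elim k)
      show ?case
      proof
        assume "w \<in> A k"
        then have "real (T i w) \<le> y (Suc k)" if "i < m (Suc k)" for i
          using elim that by (cases "i < m k") (auto simp: A_def B_def not_less)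
        then have "(\<Sum>i<m (Suc k). real (T i w)) \<le> (\<Sum>i<m (Suc k). y (Suc k))"
          by (intro sum_mono) auto
        then show "real (\<Sum>i<m (Suc k). T i w) \<le> exp (l (Suc k))" using elim by simp
      qed
    qed
    then show "\<exists>\<^sub>F k in sequentially. real (\<Sum>i<m (Suc k). T i w) \<le> exp (l (Suc k))"
      by (rule frequently_mp[OF _ conjunct2[OF w]])
  qed
  then show ?thesis
  proof (rule AE_mp, intro AE_I2 impI)
    fix w assume "\<exists>\<^sub>F k in sequentially. real (\<Sum>i<m (Suc k). T i w) \<le> exp (l (Suc k))"
    then show "\<exists>\<^sub>F k in sequentially.
      real (\<Sum>i<nat \<lfloor>\<beta>\<^sup>2 * \<kappa> * l k * ln (real (Suc k))\<rfloor>. T i w) \<le> exp (l k)"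
      unfolding m_def[symmetric] frequently_def
      by (subst (asm) eventually_sequentially_Suc[of "\<lambda>k. \<not> real (\<Sum>i<m k. T i w) \<le> exp (l k)"])
  qed
qed

text \<open>At time exp (l k) the triple logarithm is \<open>p * ln (real (Suc k))\<close> with p =
  1/\<beta>^2. This loss and the factor \<beta>^2 in the number of waiting times combine to
  \<beta>^4.\<close>

lemma limsup_ge_AE:
  fixes \<beta> :: real
  assumes \<beta>: "0 < \<beta>" "\<beta> < 1"
  shows "AE w in M. \<forall>\<xi>::nat \<Rightarrow> nat. (\<forall>m N. m < \<xi> N \<longleftrightarrow> (\<Sum>i<m. T i w) \<le> N) \<longrightarrow>
    ereal (\<beta> ^ 4 * \<kappa>) \<le> limsup (\<lambda>N. ereal (real (\<xi> N) / (ln (real N) * ln (ln (ln (real N))))))"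
  using lower_AE[OF \<beta>]
proof (rule AE_mp, intro AE_I2 impI allI)
  fix w and \<xi> :: "nat \<Rightarrow> nat"
  define p where "p = 1 / \<beta>\<^sup>2"
  define l where "l k = exp (real (Suc k) powr p)" for k
  have p: "p > 1" using \<beta> unfolding p_def by (simp add: power_less_one_iff)
  assume "\<exists>\<^sub>F k in sequentially. real (\<Sum>i<nat \<lfloor>\<beta>\<^sup>2 * \<kappa> * exp (real (Suc k) powr (1 / \<beta>\<^sup>2)) * ln (real (Suc k))\<rfloor>. T i w)
      \<le> exp (exp (real (Suc k) powr (1 / \<beta>\<^sup>2)))"
  then have freq: "\<exists>\<^sub>F k in sequentially. real (\<Sum>i<nat \<lfloor>\<beta>\<^sup>2 * \<kappa> * l k * ln (real (Suc k))\<rfloor>. T i w) \<le> exp (l k)"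
    by (simp add: l_def p_def)
  assume xi: "\<forall>m N. m < \<xi> N \<longleftrightarrow> (\<Sum>i<m. T i w) \<le> N"
  define f where "f N = real (\<xi> N) / (ln (real N) * ln (ln (ln (real N))))" for N
  define g where "g k = nat \<lfloor>exp (l k)\<rfloor>" for k
  have g: "filterlim g sequentially sequentially"
  proof -
    have "filterlim (\<lambda>k. exp (l k)) at_top sequentially" unfolding l_def using p by real_asymp
    then show ?thesis unfolding g_def
      by (intro filterlim_compose[OF filterlim_nat_sequentially] filterlim_compose[OF filterlim_floor_sequentially])
  qed
  have "\<forall>\<^sub>F N::nat in sequentially. ln (ln (ln (real N))) > 0 \<and> ln (ln (real N)) > 0 \<and> ln (real N) > 0 \<and> N > 0"
    by (intro eventually_conj; real_asymp)
  from eventually_compose_filterlim[OF this g]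
  have "\<forall>\<^sub>F k in sequentially. real (\<Sum>i<nat \<lfloor>\<beta>\<^sup>2 * \<kappa> * l k * ln (real (Suc k))\<rfloor>. T i w) \<le> exp (l k)
      \<longrightarrow> \<beta> ^ 4 * \<kappa> \<le> f (g k)"
  proof eventually_elim
    case (elim k)
    show ?case
    proof
      assume le: "real (\<Sum>i<nat \<lfloor>\<beta>\<^sup>2 * \<kappa> * l k * ln (real (Suc k))\<rfloor>. T i w) \<le> exp (l k)"
      let ?m = "nat \<lfloor>\<beta>\<^sup>2 * \<kappa> * l k * ln (real (Suc k))\<rfloor>" and ?N = "g k"
      have "(\<Sum>i<?m. T i w) \<le> ?N" using le unfolding g_def by (simp add: le_nat_iff le_floor_iff)
      then have "?m < \<xi> ?N" using xi by blast
      then have xi_ge: "\<beta>\<^sup>2 * \<kappa> * l k * ln (real (Suc k)) \<le> real (\<xi> ?N)" by linarith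
      have "real ?N \<le> exp (l k)" by (simp add: g_def)
      then have 1: "ln (real ?N) \<le> l k" using elim ln_mono[of "real ?N" "exp (l k)"] by simp
      then have "ln (ln (real ?N)) \<le> ln (l k)" using elim by (subst ln_le_cancel_iff) (auto simp: l_def)
      then have "ln (ln (ln (real ?N))) \<le> ln (ln (l k))" using elim by (subst ln_le_cancel_iff) auto
      also have "ln (ln (l k)) = ln (real (Suc k)) / \<beta>\<^sup>2" by (simp add: l_def ln_powr p_def)
      finally have 2: "ln (ln (ln (real ?N))) \<le> ln (real (Suc k)) / \<beta>\<^sup>2" .
      have "\<beta> ^ 4 * \<kappa> * (ln (real ?N) * ln (ln (ln (real ?N))))
          \<le> \<beta> ^ 4 * \<kappa> * (l k * (ln (real (Suc k)) / \<beta>\<^sup>2))"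
        using 1 2 elim kappa_pos by (intro mult_left_mono mult_mono) (auto simp: l_def)
      also have "\<dots> = \<beta>\<^sup>2 * \<kappa> * l k * ln (real (Suc k))"
        using \<beta> by (simp add: power2_eq_square power4_eq_xxxx)
      also note xi_ge
      finally show "\<beta> ^ 4 * \<kappa> \<le> f ?N" using elim by (simp add: f_def pos_le_divide_eq)
    qed
  qed
  then have "\<exists>\<^sub>F k in sequentially. \<beta> ^ 4 * \<kappa> \<le> f (g k)" by (rule frequently_mp[OF _ freq])
  then have freqN: "\<exists>\<^sub>F N in sequentially. \<beta> ^ 4 * \<kappa> \<le> f N"
    unfolding frequently_def using eventually_compose_filterlim[OF _ g] by blast
  show "ereal (\<beta> ^ 4 * \<kappa>) \<le> limsup (\<lambda>N. ereal (real (\<xi> N) / (ln (real N) * ln (ln (ln (real N))))))"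
  proof (rule ccontr)
    assume "\<not> ?thesis"
    then have "limsup (\<lambda>N. ereal (f N)) < ereal (\<beta> ^ 4 * \<kappa>)" by (simp add: f_def)
    then have "\<forall>\<^sub>F N in sequentially. ereal (f N) < ereal (\<beta> ^ 4 * \<kappa>)" by (rule Limsup_lessD)
    then have "\<forall>\<^sub>F N in sequentially. \<not> \<beta> ^ 4 * \<kappa> \<le> f N" by eventually_elim auto
    with freqN show False by (simp add: frequently_def)
  qed
qed

theorem law_of_iterated_logarithm:
  "AE w in M. \<forall>\<xi>::nat \<Rightarrow> nat. (\<forall>m N. m < \<xi> N \<longleftrightarrow> (\<Sum>i<m. T i w) \<le> N) \<longrightarrow>
    limsup (\<lambda>N. ereal (real (\<xi> N) / (ln (real N) * ln (ln (ln (real N)))))) = ereal \<kappa>"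
proof -
  define f where "f \<xi> N = ereal (real (\<xi> N) / (ln (real N) * ln (ln (ln (real N)))))" for \<xi> :: "nat \<Rightarrow> nat" and N
  \<comment> \<open>Countably many parameters tending to 1, so that the exceptional null sets can be
    united.\<close>
  define u where "u n = 1 + 1 / (real n + 1)" for n :: nat
  define v where "v n = 1 - 1 / (real n + 2)" for n :: nat
  have "AE w in M. \<forall>n. \<forall>\<xi>::nat \<Rightarrow> nat. (\<forall>m N. m < \<xi> N \<longleftrightarrow> (\<Sum>i<m. T i w) \<le> N) \<longrightarrow>
     limsup (f \<xi>) \<le> ereal ((u n)\<^sup>2 * \<kappa> * u n)"
    unfolding AE_all_countable f_def u_def by (intro allI limsup_le_AE) auto
  moreover have "AE w in M. \<forall>n. \<forall>\<xi>::nat \<Rightarrow> nat. (\<forall>m N. m < \<xi> N \<longleftrightarrow> (\<Sum>i<m. T i w) \<le> N) \<longrightarrow>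
     ereal (v n ^ 4 * \<kappa>) \<le> limsup (f \<xi>)"
    unfolding AE_all_countable f_def v_def by (intro allI limsup_ge_AE) auto
  ultimately show ?thesis
  proof eventually_elim
    case (elim w)
    have "(\<lambda>n. ereal ((u n)\<^sup>2 * \<kappa> * u n)) \<longlonglongrightarrow> ereal \<kappa>"
      unfolding u_def by (intro tendsto_ereal) real_asymp
    moreover have "(\<lambda>n. ereal (v n ^ 4 * \<kappa>)) \<longlonglongrightarrow> ereal \<kappa>"
      unfolding v_def by (intro tendsto_ereal) real_asymp
    ultimately show ?case
      using elim unfolding f_def[symmetric]
      by (intro allI impI antisym) (blast intro: LIMSEQ_le_const LIMSEQ_le_const2)+
  qed
qed

end

section \<open>From the Green function to the local time\<close>

text \<open>U(x) grows like \<kappa> ln x, so 1 - \<phi>(1/x) = 1 / U(x) tends to 0. As \<phi>(1/x)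
  is at most the total mass of \<open>gap_prob\<close>, that mass is 1, and the recurrent theory
  applies.\<close>

lemma (in finite_range_chain) local_time_iterated_logarithm:
  assumes \<kappa>: "\<kappa> > 0"
    and green: "((\<lambda>x. (\<Sum>n. exp (- 1 / x) ^ n * chain_prob p nb a n a) / ln x) \<longlongrightarrow> \<kappa>) at_top"
  shows "AE w in M. limsup (\<lambda>N. ereal (real (local_time X a N w)
           / (ln (real N) * ln (ln (ln (real N)))))) = ereal \<kappa>"
proof -
  define \<phi> where "\<phi> t = (\<Sum>n. exp (- t) ^ n * gap_prob n)" for t
  define U where "U x = (\<Sum>n. exp (- 1 / x) ^ n * chain_prob p nb a n a)" for x :: real
  have gen: "U x * (1 - \<phi> (1 / x)) = 1" "\<phi> (1 / x) \<le> suminf gap_prob" if "x > 0" for x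
    using generating_functions(1,2)[of "exp (- 1 / x)"] that by (simp_all add: U_def \<phi>_def)
  have "((\<lambda>x. inverse (U x / ln x)) \<longlongrightarrow> inverse \<kappa>) at_top"
    using green \<kappa> unfolding U_def by (intro tendsto_inverse) auto
  moreover have "\<forall>\<^sub>F x in at_top. inverse (U x / ln x) = (1 - \<phi> (1 / x)) * ln x"
    using eventually_gt_at_top[of 0]
  proof eventually_elim
    case (elim x)
    have "inverse (U x) = 1 - \<phi> (1 / x)" by (rule inverse_unique[OF gen(1)[OF elim]])
    then show ?case by (simp add: inverse_eq_divide[symmetric] divide_inverse)
  qed
  ultimately have lim: "((\<lambda>x. (1 - \<phi> (1 / x)) * ln x) \<longlongrightarrow> 1 / \<kappa>) at_top"
    by (simp add: tendsto_cong inverse_eq_divide)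
  have "((\<lambda>x. 1 - ((1 - \<phi> (1 / x)) * ln x) / ln x) \<longlongrightarrow> 1 - 0) at_top"
    by (intro tendsto_diff tendsto_const tendsto_divide_0[OF lim] filterlim_at_top_imp_at_infinity ln_at_top)
  moreover have "\<forall>\<^sub>F x in at_top. 1 - ((1 - \<phi> (1 / x)) * ln x) / ln x \<le> suminf gap_prob"
    using eventually_gt_at_top[of 1]
  proof eventually_elim
    case (elim x)
    then have "ln x \<noteq> 0" "x > 0" by auto
    then show ?case using gen(2)[of x] by simp
  qed
  ultimately have "1 - 0 \<le> suminf gap_prob"
    by (intro tendsto_upperbound[where F = at_top]) auto
  then have "suminf gap_prob = 1" using suminf_gap_prob_le by linarith
  then interpret recurrent_chain M X p nb a by unfold_locales
  interpret renewal_process M waiting \<phi> \<kappa>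
  proof
    show "expectation (\<lambda>w. exp (- t * real (waiting i w))) = \<phi> t" if "t > 0" for i t
      unfolding \<phi>_def by (rule laplace_waiting[OF that])
    show "indep_vars (\<lambda>_. count_space UNIV) waiting UNIV" by (rule indep_waiting)
    show "\<kappa> > 0" by (rule \<kappa>)
    show "((\<lambda>x. (1 - \<phi> (1 / x)) * ln x) \<longlongrightarrow> 1 / \<kappa>) at_top" by (rule lim)
  qed
  show ?thesis
    using law_of_iterated_logarithm AE_recurs
  proof eventually_elim
    case (elim w)
    show ?case
      by (rule elim(1)[THEN spec[of _ "\<lambda>N. local_time X a N w"], THEN mp])
         (intro allI less_local_time_iff elim(2))
  qed
qed

section \<open>Green function of the half-plane half-comb walk\<close>

text \<open>Solutions combine l^n and l^(-n). The difference \<open>D\<close> annihilates the first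
  and is a multiple of the second, so boundedness forces it to be 0.\<close>

lemma bounded_second_order_recurrence:
  fixes G :: "nat \<Rightarrow> real" and l :: real
  assumes l: "0 < l" "l < 1"
    and bound: "\<And>n. \<bar>G n\<bar> \<le> B"
    and rec: "\<And>n. G (Suc (Suc n)) + G n = (l + 1 / l) * G (Suc n)"
  shows "G 1 = l * G 0"
proof -
  define D where "D n = G (Suc n) - l * G n" for n
  have D_Suc: "D n = l * D (Suc n)" for n
    using rec[of n] l by (simp add: D_def field_simps)
  have D0: "D 0 = l ^ n * D n" for n
    by (induction n) (simp, simp add: D_Suc[symmetric] mult.assoc)
  have D_bound: "\<bar>D n\<bar> \<le> 2 * B" for n
  proof -
    have "l * \<bar>G n\<bar> \<le> 1 * B"
      using l bound[of n] by (intro mult_mono) auto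
    then show ?thesis
      using bound[of "Suc n"] l abs_triangle_ineq4[of "G (Suc n)" "l * G n"]
      by (simp add: D_def abs_mult)
  qed
  have le: "\<bar>D 0\<bar> \<le> l ^ n * (2 * B)" for n
    using D0[of n] D_bound[of n] l by (simp add: abs_mult mult_left_mono)
  have "(\<lambda>n. l ^ n * (2 * B)) \<longlonglongrightarrow> 0 * (2 * B)"
    using l by (intro tendsto_mult LIMSEQ_realpow_zero) auto
  then have "\<bar>D 0\<bar> \<le> 0 * (2 * B)"
    using le by (intro LIMSEQ_le_const) auto
  then show ?thesis by (simp add: D_def)
qed

section \<open>Horizontal Fourier transform and closed form of the Green function\<close>

definition hphc_nb :: "int \<times> int \<Rightarrow> (int \<times> int) set" where
  "hphc_nb x = {(fst x + 1, snd x), (fst x - 1, snd x), (fst x, snd x + 1), (fst x, snd x - 1)}"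

lemma sum_hphc_nb:
  "(\<Sum>y\<in>hphc_nb (k, j). hphc_trans (k, j) y * f y) =
    (1/2 - hphc_p j) * (f (k + 1, j) + f (k - 1, j)) + hphc_p j * (f (k, j + 1) + f (k, j - 1))"
  by (simp add: hphc_nb_def algebra_simps)

text \<open>The transform of \<open>chain_prob\<close> in the horizontal coordinate at frequency t,
  with c = cos t. It is real because the horizontal steps are symmetric; a horizontal step, of total
  probability \<open>1 - 2 * hphc_p j\<close>, multiplies it by c.\<close>

primrec hphc_fourier :: "real \<Rightarrow> nat \<Rightarrow> int \<Rightarrow> real" where
  "hphc_fourier c 0 j = of_bool (j = 0)"
| "hphc_fourier c (Suc n) j = (1 - 2 * hphc_p j) * c * hphc_fourier c n j
     + hphc_p j * (hphc_fourier c n (j + 1) + hphc_fourier c n (j - 1))"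

lemma abs_hphc_fourier_le_1:
  assumes "\<bar>c\<bar> \<le> 1"
  shows "\<bar>hphc_fourier c n j\<bar> \<le> 1"
proof (induction n arbitrary: j)
  case (Suc n)
  have "\<bar>c * hphc_fourier c n j\<bar> \<le> 1"
    using mult_mono[OF assms Suc.IH[of j]] by (simp add: abs_mult)
  moreover have "hphc_fourier c (Suc n) j =
      (if j \<ge> 0 then (c * hphc_fourier c n j) / 2 + (hphc_fourier c n (j + 1) + hphc_fourier c n (j - 1)) / 4
       else (hphc_fourier c n (j + 1) + hphc_fourier c n (j - 1)) / 2)"
    by (simp add: hphc_p_def)
  moreover have "\<bar>x / 2 + (y + z) / 4\<bar> \<le> 1" "\<bar>(y + z) / 2\<bar> \<le> 1"
    if "\<bar>x\<bar> \<le> 1" "\<bar>y\<bar> \<le> 1" "\<bar>z\<bar> \<le> 1" for x y z :: real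
    using that unfolding add_divide_distrib by - linarith+
  ultimately show ?case
    using Suc.IH[of "j + 1"] Suc.IH[of "j - 1"] by (simp del: hphc_fourier.simps)
qed simp

lemma continuous_on_hphc_fourier [continuous_intros]:
  "continuous_on A (\<lambda>t. hphc_fourier (cos t) n j)"
  by (induction n arbitrary: j) (auto intro!: continuous_intros)

lemma integral_cos_int:
  "integral {0..pi} (\<lambda>t. cos (real_of_int k * t)) = (if k = 0 then pi else 0)"
proof (cases "k = 0")
  case False
  have "((\<lambda>t. cos (real_of_int k * t)) has_integral
          sin (real_of_int k * pi) / real_of_int k - sin (real_of_int k * 0) / real_of_int k) {0..pi}"
    using False
    by (intro fundamental_theorem_of_calculus)
       (auto intro!: derivative_eq_intros simp flip: has_real_derivative_iff_has_vector_derivative)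
  then have "((\<lambda>t. cos (real_of_int k * t)) has_integral 0) {0..pi}"
    by (simp add: sin_integer_2pi mult.commute[of _ pi] sin_zero_iff_int2)
  then show ?thesis using False by (simp add: integral_unique)
qed simp

text \<open>Fourier inversion for a function even in k. The base case is orthogonality of cosines;
  the induction step is cos ((k+1) t) + cos ((k-1) t) = 2 cos t cos (k t).\<close>

lemma hphc_chain_prob_fourier:
  "chain_prob hphc_trans hphc_nb (0, 0) n (k, j) =
    1 / pi * integral {0..pi} (\<lambda>t. cos (real_of_int k * t) * hphc_fourier (cos t) n j)"
proof (induction n arbitrary: k j)
  case 0
  then show ?case by (auto simp: integral_cos_int)
next
  case (Suc n)
  let ?f = "\<lambda>k j t. cos (real_of_int k * t) * hphc_fourier (cos t) n j"
  have int: "?f k j integrable_on {0..pi}" for k j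
    by (intro integrable_continuous_interval continuous_intros)
  have "(?f (k + 1) j has_integral integral {0..pi} (?f (k + 1) j)) {0..pi}"
       "(?f (k - 1) j has_integral integral {0..pi} (?f (k - 1) j)) {0..pi}"
       "(?f k (j + 1) has_integral integral {0..pi} (?f k (j + 1))) {0..pi}"
       "(?f k (j - 1) has_integral integral {0..pi} (?f k (j - 1))) {0..pi}"
    by (rule integrable_integral[OF int])+
  then have "((\<lambda>t. (1/2 - hphc_p j) * (?f (k + 1) j t + ?f (k - 1) j t)
        + hphc_p j * (?f k (j + 1) t + ?f k (j - 1) t)) has_integral
      (1/2 - hphc_p j) * (integral {0..pi} (?f (k + 1) j) + integral {0..pi} (?f (k - 1) j))
        + hphc_p j * (integral {0..pi} (?f k (j + 1)) + integral {0..pi} (?f k (j - 1)))) {0..pi}"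
    by (intro has_integral_add has_integral_mult_right)
  moreover have "(\<lambda>t. (1/2 - hphc_p j) * (?f (k + 1) j t + ?f (k - 1) j t)
        + hphc_p j * (?f k (j + 1) t + ?f k (j - 1) t)) =
      (\<lambda>t. cos (real_of_int k * t) * hphc_fourier (cos t) (Suc n) j)"
    by (intro ext) (simp add: distrib_right left_diff_distrib cos_add cos_diff, simp add: algebra_simps)
  ultimately show ?case
    by (simp add: sum_hphc_nb Suc.IH integral_unique del: hphc_fourier.simps)
       (simp add: field_simps)
qed

definition hphc_green :: "real \<Rightarrow> real \<Rightarrow> int \<Rightarrow> real" where
  "hphc_green s c j = (\<Sum>n. s ^ n * hphc_fourier c n j)"

text \<open>
  With \<open>\<lambda>, \<mu> < 1\<close> the decay rates of the bounded solutions in the upper and the lower half plane,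
  given by \<open>\<lambda> + 1/\<lambda> = 4/s - 2c\<close> and \<open>\<mu> + 1/\<mu> = 2/s\<close>, this is \<open>1/\<lambda> - \<mu>\<close>.
\<close>
definition hphc_denom :: "real \<Rightarrow> real \<Rightarrow> real" where
  "hphc_denom s c = 1/s - c + sqrt ((2/s - c)\<^sup>2 - 1) + sqrt ((1/s)\<^sup>2 - 1)"

lemma abs_power_hphc_fourier_le:
  assumes "0 < s" "\<bar>c\<bar> \<le> 1"
  shows "\<bar>s ^ n * hphc_fourier c n j\<bar> \<le> s ^ n"
proof -
  have "\<bar>s ^ n * hphc_fourier c n j\<bar> = s ^ n * \<bar>hphc_fourier c n j\<bar>"
    using assms(1) by (simp only: abs_mult abs_of_pos zero_less_power)
  also have "\<dots> \<le> s ^ n"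
    using assms by (intro mult_left_le abs_hphc_fourier_le_1) auto
  finally show ?thesis .
qed

lemma sums_hphc_green:
  assumes "0 < s" "s < 1" "\<bar>c\<bar> \<le> 1"
  shows "(\<lambda>n. s ^ n * hphc_fourier c n j) sums hphc_green s c j"
  unfolding hphc_green_def
proof (rule summable_sums, rule summable_comparison_test'[of "\<lambda>n. s ^ n" 0])
  show "summable (\<lambda>n. s ^ n)" using assms by (intro summable_geometric) simp
  show "norm (s ^ n * hphc_fourier c n j) \<le> s ^ n" for n
    unfolding real_norm_def by (rule abs_power_hphc_fourier_le[OF assms(1,3)])
qed

lemma abs_hphc_green_le:
  assumes "0 < s" "s < 1" "\<bar>c\<bar> \<le> 1"
  shows "\<bar>hphc_green s c j\<bar> \<le> 1 / (1 - s)"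
proof -
  have geo: "(\<lambda>n. s ^ n) sums (1 / (1 - s))"
    using assms geometric_sums[of s] by simp
  have "norm (hphc_green s c j) \<le> (\<Sum>n. s ^ n)"
    unfolding hphc_green_def
  proof (rule norm_suminf_le)
    show "norm (s ^ n * hphc_fourier c n j) \<le> s ^ n" for n
      unfolding real_norm_def by (rule abs_power_hphc_fourier_le[OF assms(1,3)])
    show "summable (\<lambda>n. s ^ n)" using geo by (rule sums_summable)
  qed
  then show ?thesis using geo by (simp add: sums_iff)
qed

lemma hphc_green_rec:
  assumes s: "0 < s" "s < 1" "\<bar>c\<bar> \<le> 1"
  shows "hphc_green s c j = of_bool (j = 0) + s * ((1 - 2 * hphc_p j) * c * hphc_green s c j
     + hphc_p j * (hphc_green s c (j + 1) + hphc_green s c (j - 1)))"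
proof -
  have "(\<lambda>n. s * ((1 - 2 * hphc_p j) * c * (s ^ n * hphc_fourier c n j)
     + hphc_p j * (s ^ n * hphc_fourier c n (j + 1) + s ^ n * hphc_fourier c n (j - 1)))) sums
     (s * ((1 - 2 * hphc_p j) * c * hphc_green s c j
     + hphc_p j * (hphc_green s c (j + 1) + hphc_green s c (j - 1))))"
    using sums_hphc_green[OF s] by (intro sums_mult sums_add)
  then have "(\<lambda>n. s ^ Suc n * hphc_fourier c (Suc n) j) sums
     (s * ((1 - 2 * hphc_p j) * c * hphc_green s c j
     + hphc_p j * (hphc_green s c (j + 1) + hphc_green s c (j - 1))))"
    by (simp add: algebra_simps)
  from sums_Suc[OF this] show ?thesis
    using sums_hphc_green[OF s, of j] by (simp add: sums_iff)
qed

lemma root_of_reciprocal_sum: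
  fixes a :: real
  assumes "a > 1"
  defines "l \<equiv> a - sqrt (a\<^sup>2 - 1)"
  shows "0 < l" "l < 1" "1 / l = a + sqrt (a\<^sup>2 - 1)" "l + 1 / l = 2 * a"
proof -
  have a2: "a\<^sup>2 > 1" using assms by (simp add: power_gt1)
  have "sqrt (a\<^sup>2 - 1) < sqrt (a\<^sup>2)" by (intro real_sqrt_less_mono) simp
  then show pos: "0 < l" using assms by simp
  have "(a - 1)\<^sup>2 < a\<^sup>2 - 1" using assms(1) by (simp add: power2_eq_square algebra_simps)
  then have "sqrt ((a - 1)\<^sup>2) < sqrt (a\<^sup>2 - 1)" by (intro real_sqrt_less_mono)
  then show "l < 1" using assms(1) by (simp add: l_def)
  have "l * (a + sqrt (a\<^sup>2 - 1)) = 1"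
    using a2 by (simp add: l_def algebra_simps flip: power2_eq_square)
  then show inv: "1 / l = a + sqrt (a\<^sup>2 - 1)" using pos by (simp add: field_simps)
  show "l + 1 / l = 2 * a" unfolding inv by (simp add: l_def)
qed

text \<open>Strictly above and strictly below row 0 the recursion has constant coefficients, so
  boundedness gives the ratios \<open>l\<close> and \<open>m\<close> for the rows 1 and -1. Row 0
  carries the source and follows the upper rule, which yields the factor 2 a - l - m = 1/l -
  m.\<close>

lemma hphc_green_closed_form:
  assumes s: "0 < s" "s < 1" "\<bar>c\<bar> \<le> 1"
  shows "hphc_green s c 0 * hphc_denom s c = 4 / s"
proof -
  let ?G = "hphc_green s c"
  define a where "a = 2/s - c"
  define l where "l = a - sqrt (a\<^sup>2 - 1)"
  define m where "m = 1/s - sqrt ((1/s)\<^sup>2 - 1)"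
  have s1: "1/s > 1" using s by simp
  then have "2/s > 2" using s by (simp add: field_simps)
  then have a1: "a > 1" using s(3) by (simp add: a_def abs_le_iff)
  note l = root_of_reciprocal_sum[OF a1, folded l_def]
  note m = root_of_reciprocal_sum[OF s1, folded m_def]
  have up: "?G 1 = l * ?G 0"
  proof -
    have "?G (int (Suc (Suc n))) + ?G (int n) = (l + 1 / l) * ?G (int (Suc n))" for n
      using hphc_green_rec[OF s, of "int (Suc n)"] s(1) unfolding l(4) a_def
      by (simp add: hphc_p_def field_simps)
    from bounded_second_order_recurrence[of l "\<lambda>n. ?G (int n)", OF l(1,2) abs_hphc_green_le[OF s] this]
    show ?thesis by simp
  qed
  have down: "?G (-1) = m * ?G 0"
  proof -
    have "?G (- int (Suc (Suc n))) + ?G (- int n) = (m + 1 / m) * ?G (- int (Suc n))" for n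
      using hphc_green_rec[OF s, of "- int (Suc n)"] s(1) unfolding m(4)
      by (simp add: hphc_p_def field_simps)
    from bounded_second_order_recurrence[of m "\<lambda>n. ?G (- int n)", OF m(1,2) abs_hphc_green_le[OF s] this]
    show ?thesis by simp
  qed
  have "?G 0 = 1 + s * (c / 2 * ?G 0 + (l * ?G 0 + m * ?G 0) / 4)"
    using hphc_green_rec[OF s, of 0] by (simp add: hphc_p_def up down)
  then have "?G 0 * (2 * a - l - m) = 4 / s"
    using s(1) by (simp add: a_def field_simps)
  also have "2 * a - l - m = hphc_denom s c"
    by (simp add: l_def m_def hphc_denom_def a_def)
  finally show ?thesis .
qed

section \<open>Two-sided bounds for the denominator\<close>

lemma sin_ge_cubic:
  fixes x :: real
  assumes "0 \<le> x"
  shows "x - x ^ 3 / 6 \<le> sin x"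
proof -
  have cos_ge: "1 - y\<^sup>2 / 2 \<le> cos y" for y :: real
  proof -
    have "cos y = 1 - 2 * (sin (y / 2))\<^sup>2"
      using cos_double_sin[of "y / 2"] by simp
    moreover have "(sin (y / 2))\<^sup>2 \<le> (y / 2)\<^sup>2"
      using abs_sin_x_le_abs_x[of "y / 2"] by (rule abs_le_square_iff[THEN iffD1])
    ultimately show ?thesis by (simp add: power_divide)
  qed
  define g where "g = (\<lambda>x::real. sin x - x + x ^ 3 / 6)"
  have "g 0 \<le> g x"
  proof (rule DERIV_nonneg_imp_nondecreasing[OF assms])
    fix y :: real
    have "(g has_real_derivative (cos y - 1 + y\<^sup>2 / 2)) (at y)"
      unfolding g_def by (auto intro!: derivative_eq_intros)
    then show "\<exists>d. (g has_real_derivative d) (at y) \<and> 0 \<le> d"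
      using cos_ge[of y] by (intro exI[of _ "cos y - 1 + y\<^sup>2 / 2"]) auto
  qed
  then show ?thesis by (simp add: g_def)
qed

text \<open>With b = 1 - cos t = 2 sin^2 (t/2), the first radicand is at least 2 b = (2 sin (t/2))^2
  and the second at least e. The remaining term e + b is nonnegative and is dropped.\<close>

lemma hphc_denom_ge:
  fixes e t :: real
  assumes e: "0 < e" and t: "0 \<le> t" "t \<le> pi" and s: "1 / s = 1 + e"
  shows "t - t ^ 3 / 24 + sqrt e \<le> hphc_denom s (cos t)"
proof -
  have half: "1 - cos t = 2 * (sin (t / 2))\<^sup>2" using cos_double_sin[of "t / 2"] by simp
  have "(2 * sin (t / 2))\<^sup>2 \<le> (2 * (1 + e) - cos t)\<^sup>2 - 1"
  proof -
    define b where "b = 1 - cos t"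
    have "b \<ge> 0" by (simp add: b_def)
    then have "2 * b \<le> (1 + 2 * e + b)\<^sup>2 - 1"
      using e by (simp add: power2_eq_square algebra_simps)
    moreover have "2 * (1 + e) - cos t = 1 + 2 * e + b" by (simp add: b_def)
    moreover have "(2 * sin (t / 2))\<^sup>2 = 2 * b" using half by (simp add: b_def power_mult_distrib)
    ultimately show ?thesis by metis
  qed
  then have "sqrt ((2 * sin (t / 2))\<^sup>2) \<le> sqrt ((2 * (1 + e) - cos t)\<^sup>2 - 1)"
    by (rule real_sqrt_le_mono)
  moreover have "0 \<le> sin (t / 2)" using t by (intro sin_ge_zero) auto
  ultimately have 1: "2 * sin (t / 2) \<le> sqrt ((2 * (1 + e) - cos t)\<^sup>2 - 1)"
    by (simp only: real_sqrt_abs abs_of_nonneg mult_nonneg_nonneg zero_le_numeral)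
  have 2: "sqrt e \<le> sqrt ((1 + e)\<^sup>2 - 1)"
    using e by (intro real_sqrt_le_mono) (simp add: power2_eq_square algebra_simps)
  have "t / 2 - (t / 2) ^ 3 / 6 \<le> sin (t / 2)" using t by (intro sin_ge_cubic) auto
  then have 3: "t - t ^ 3 / 24 \<le> 2 * sin (t / 2)" by (simp add: power_divide)
  have s2: "2 / s = 2 * (1 + e)" using s by (simp add: field_simps)
  show ?thesis using 1 2 3 e cos_le_one[of t]
    unfolding hphc_denom_def s s2 by linarith
qed

text \<open>Both radicands have the form y^2 + 2 y, with y = 1 - cos t + 2 e and y = e, so
  subadditivity of the square root applies. The terms in e add up to 4 e + 4 sqrt e, at most 8 sqrt
  e for e <= 1.\<close>

lemma hphc_denom_le:
  fixes e t :: real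
  assumes e: "0 < e" "e \<le> 1" and t: "0 \<le> t" and s: "1 / s = 1 + e"
  shows "hphc_denom s (cos t) \<le> t + t\<^sup>2 + 8 * sqrt e"
proof -
  have sqrt_sq: "sqrt (y\<^sup>2 + 2 * y) \<le> y + sqrt (2 * y)" if "y \<ge> 0" for y :: real
    using that sqrt_add_le_add_sqrt[of "y\<^sup>2" "2 * y"] by simp
  have half: "1 - cos t = 2 * (sin (t / 2))\<^sup>2" using cos_double_sin[of "t / 2"] by simp
  have "(sin (t / 2))\<^sup>2 \<le> (t / 2)\<^sup>2"
    using abs_sin_x_le_abs_x[of "t / 2"] by (rule abs_le_square_iff[THEN iffD1])
  then have cos_le: "1 - cos t \<le> t\<^sup>2 / 2" by (simp add: half power_divide)
  define b where "b = 1 - cos t + 2 * e"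
  have b: "0 \<le> b" "b \<le> t\<^sup>2 / 2 + 2 * e"
    using cos_le e by (auto simp: b_def add_nonneg_nonneg)
  have "sqrt ((2 * (1 + e) - cos t)\<^sup>2 - 1) = sqrt (b\<^sup>2 + 2 * b)"
    by (simp add: b_def power2_eq_square algebra_simps)
  also have "\<dots> \<le> b + sqrt (2 * b)" by (rule sqrt_sq[OF b(1)])
  also have "sqrt (2 * b) \<le> sqrt (t\<^sup>2 + 4 * e)" using b by (intro real_sqrt_le_mono) auto
  also have "\<dots> \<le> t + 2 * sqrt e"
    using sqrt_add_le_add_sqrt[of "t\<^sup>2" "4 * e"] t e by (simp add: real_sqrt_mult)
  finally have 1: "sqrt ((2 * (1 + e) - cos t)\<^sup>2 - 1) \<le> t\<^sup>2 / 2 + 2 * e + t + 2 * sqrt e"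
    using b by simp
  have "sqrt ((1 + e)\<^sup>2 - 1) = sqrt (e\<^sup>2 + 2 * e)" by (simp add: power2_eq_square algebra_simps)
  also have "\<dots> \<le> e + sqrt (2 * e)" using e by (intro sqrt_sq) auto
  also have "sqrt (2 * e) \<le> sqrt (4 * e)" using e by (intro real_sqrt_le_mono) auto
  also have "\<dots> = 2 * sqrt e" by (simp add: real_sqrt_mult)
  finally have 2: "sqrt ((1 + e)\<^sup>2 - 1) \<le> e + 2 * sqrt e" by simp
  have "sqrt e * sqrt e \<le> 1 * sqrt e" using e by (intro mult_right_mono) auto
  then have 3: "e \<le> sqrt e" using e by simp
  have s2: "2 / s = 2 * (1 + e)" using s by (simp add: field_simps)
  show ?thesis unfolding hphc_denom_def s s2 using 1 2 3 cos_le by linarith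
qed

text \<open>The error has to be additive: it integrates to a bounded amount, negligible against the
  logarithm. Likewise the factor 8 shifts the logarithm only by a bounded amount.\<close>

lemma inverse_hphc_denom_bounds:
  fixes e t :: real
  assumes e: "0 < e" "e \<le> 1" and t: "0 \<le> t" "t \<le> pi" and s: "1 / s = 1 + e"
  shows "1 / (t + 8 * sqrt e) - 1 \<le> 1 / hphc_denom s (cos t)"
    and "1 / hphc_denom s (cos t) \<le> 1 / (t + sqrt e) + 1"
    and "0 < hphc_denom s (cos t)"
proof -
  define w where "w = t - t ^ 3 / 24"
  \<comment> \<open>Precise enough for t^2/24 + t/24 <= 1 on [0, pi], which gives 0 <= w and t <= w
    (1 + t).\<close>
  have "pi \<le> 3.2" by (rule order_trans[OF pi_approx(2)]) simp
  then have t4: "t \<le> 3.2" using t by linarith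
  have t2: "t\<^sup>2 \<le> 3.2\<^sup>2" using t t4 by (intro power_mono) auto
  have w': "w = t * (1 - t\<^sup>2 / 24)" by (simp add: w_def power3_eq_cube power2_eq_square algebra_simps)
  have w0: "0 \<le> w" using t t2 unfolding w' by (intro mult_nonneg_nonneg) (auto simp: power2_eq_square)
  have wt: "t - w \<le> w * t"
  proof -
    have "w * t - (t - w) = t\<^sup>2 * (1 - t\<^sup>2 / 24 - t / 24)"
      by (simp add: w_def power3_eq_cube power2_eq_square algebra_simps)
    also have "\<dots> \<ge> 0" using t2 t4 by (intro mult_nonneg_nonneg) (auto simp: power2_eq_square)
    finally show ?thesis by simp
  qed
  define q where "q = sqrt e"
  have q: "q > 0" using e by (simp add: q_def)
  have ge: "w + q \<le> hphc_denom s (cos t)"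
    using hphc_denom_ge[OF e(1) t s] by (simp add: w_def q_def)
  show pos: "0 < hphc_denom s (cos t)" using ge w0 q by linarith
  have "t + q \<le> (w + q) * (1 + t + q)"
  proof -
    have "0 \<le> w * q" "0 \<le> q * (t + q)" using w0 q t by simp_all
    then show ?thesis using wt by (simp add: algebra_simps)
  qed
  then have "1 / (w + q) \<le> 1 / (t + q) + 1"
    using q w0 t by (simp add: divide_simps) (simp add: algebra_simps)
  moreover have "1 / hphc_denom s (cos t) \<le> 1 / (w + q)"
    using ge q w0 by (intro divide_left_mono mult_pos_pos pos) auto
  ultimately show "1 / hphc_denom s (cos t) \<le> 1 / (t + sqrt e) + 1"
    by (simp add: q_def)
  define r where "r = t + 8 * q"
  have r: "r > 0" "t \<le> r" using t q by (auto simp: r_def)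
  have "1 / r - 1 \<le> 1 / (r + t\<^sup>2)"
  proof -
    have "(r + t\<^sup>2) * (1 - r) = r - (r\<^sup>2 - t\<^sup>2) - t\<^sup>2 * r"
      by (simp add: power2_eq_square algebra_simps)
    also have "\<dots> \<le> r"
    proof -
      have "t\<^sup>2 \<le> r\<^sup>2" "0 \<le> t\<^sup>2 * r" using r t by (auto intro: power_mono)
      then show ?thesis by linarith
    qed
    finally have *: "(r + t\<^sup>2) * (1 - r) \<le> r" .
    have rt: "r + t\<^sup>2 > 0" using r by (simp add: add_pos_nonneg)
    have "1 - r \<le> r / (r + t\<^sup>2)" using * rt by (simp add: pos_le_divide_eq mult.commute)
    then have "(1 - r) / r \<le> (r / (r + t\<^sup>2)) / r" using r by (intro divide_right_mono) auto
    then show ?thesis using r by (simp add: diff_divide_distrib)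
  qed
  moreover have "1 / (r + t\<^sup>2) \<le> 1 / hphc_denom s (cos t)"
    using hphc_denom_le[OF e t(1) s] pos
    by (intro divide_left_mono mult_pos_pos) (auto simp: r_def q_def add_pos_nonneg add_ac)
  ultimately show "1 / (t + 8 * sqrt e) - 1 \<le> 1 / hphc_denom s (cos t)"
    by (simp add: r_def q_def)
qed

section \<open>Asymptotics of the Green function at the origin\<close>

lemma has_integral_inverse_shift:
  fixes q d :: real
  assumes "q > 0"
  shows "((\<lambda>t. 1 / (t + q) + d) has_integral (ln ((pi + q) / q) + d * pi)) {0..pi}"
proof -
  have "((\<lambda>t. 1 / (t + q) + d) has_integral
      ((ln (pi + q) + d * pi) - (ln (0 + q) + d * 0))) {0..pi}"
    using assms
    by (intro fundamental_theorem_of_calculus)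
       (auto intro!: derivative_eq_intros simp flip: has_real_derivative_iff_has_vector_derivative)
  then show ?thesis using assms pi_gt_zero by (simp add: ln_div add_pos_pos algebra_simps del: pi_gt_zero)
qed

text \<open>The geometric majorant \<open>s ^ n\<close> makes the series converge uniformly in t, so
  sum and integral commute. Integrability of the reciprocal of the denominator is inherited from
  this uniform limit.\<close>

lemma hphc_generating_function:
  assumes s: "0 < s" "s < 1"
  shows "(\<lambda>n. s ^ n * chain_prob hphc_trans hphc_nb (0, 0) n (0, 0)) sums
           (4 / (pi * s) * integral {0..pi} (\<lambda>t. 1 / hphc_denom s (cos t)))"
    and "(\<lambda>t. 1 / hphc_denom s (cos t)) integrable_on {0..pi}"
proof -
  have unif: "uniform_limit {0..pi} (\<lambda>N t. \<Sum>n<N. s ^ n * hphc_fourier (cos t) n 0)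
      (\<lambda>t. \<Sum>n. s ^ n * hphc_fourier (cos t) n 0) sequentially"
  proof (rule Weierstrass_m_test)
    show "norm (s ^ n * hphc_fourier (cos t) n 0) \<le> s ^ n" for n t
      unfolding real_norm_def by (rule abs_power_hphc_fourier_le[OF s(1)]) simp
    show "summable (\<lambda>n. s ^ n)" using s by (intro summable_geometric) simp
  qed
  obtain I J where IJ: "\<And>N. ((\<lambda>t. \<Sum>n<N. s ^ n * hphc_fourier (cos t) n 0) has_integral I N) {0..pi}"
      "((\<lambda>t. \<Sum>n. s ^ n * hphc_fourier (cos t) n 0) has_integral J) {0..pi}" "I \<longlonglongrightarrow> J"
    by (rule uniform_limit_integral[OF unif]) (auto intro!: continuous_intros)
  have green: "(\<Sum>n. s ^ n * hphc_fourier (cos t) n 0) = 4 / s * (1 / hphc_denom s (cos t))" for t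
  proof -
    have "hphc_green s (cos t) 0 * hphc_denom s (cos t) = 4 / s"
      by (rule hphc_green_closed_form[OF s]) simp
    moreover from this have "hphc_denom s (cos t) \<noteq> 0" using s by auto
    ultimately have "hphc_green s (cos t) 0 = 4 / s / hphc_denom s (cos t)"
      by (metis nonzero_eq_divide_eq)
    then show ?thesis by (simp add: hphc_green_def)
  qed
  have J: "((\<lambda>t. 4 / s * (1 / hphc_denom s (cos t))) has_integral J) {0..pi}"
    using IJ(2) unfolding green .
  from has_integral_mult_right[OF J, of "s / 4"]
  have J': "((\<lambda>t. 1 / hphc_denom s (cos t)) has_integral (s / 4 * J)) {0..pi}"
    using s by simp
  then show "(\<lambda>t. 1 / hphc_denom s (cos t)) integrable_on {0..pi}" by blast
  have "I N = pi * (\<Sum>n<N. s ^ n * chain_prob hphc_trans hphc_nb (0, 0) n (0, 0))" for N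
  proof -
    have "((\<lambda>t. \<Sum>n<N. s ^ n * hphc_fourier (cos t) n 0) has_integral
       (\<Sum>n<N. s ^ n * integral {0..pi} (\<lambda>t. hphc_fourier (cos t) n 0))) {0..pi}"
      by (intro has_integral_sum has_integral_mult_right integrable_integral
            integrable_continuous_interval continuous_intros) auto
    with IJ(1) have "I N = (\<Sum>n<N. s ^ n * integral {0..pi} (\<lambda>t. hphc_fourier (cos t) n 0))"
      by (rule has_integral_unique)
    then show ?thesis by (simp add: hphc_chain_prob_fourier sum_distrib_left mult_ac)
  qed
  then have "I = (\<lambda>N. pi * (\<Sum>n<N. s ^ n * chain_prob hphc_trans hphc_nb (0, 0) n (0, 0)))"
    by (rule ext)
  with IJ(3) have "(\<lambda>N. pi * (\<Sum>n<N. s ^ n * chain_prob hphc_trans hphc_nb (0, 0) n (0, 0))) \<longlonglongrightarrow> J"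
    by (simp only:)
  from tendsto_divide[OF this tendsto_const[of pi]]
  have "(\<lambda>N. \<Sum>n<N. s ^ n * chain_prob hphc_trans hphc_nb (0, 0) n (0, 0)) \<longlonglongrightarrow> J / pi"
    by simp
  moreover have "4 / (pi * s) * integral {0..pi} (\<lambda>t. 1 / hphc_denom s (cos t)) = J / pi"
    using s integral_unique[OF J'] by (simp add: field_simps)
  ultimately show "(\<lambda>n. s ^ n * chain_prob hphc_trans hphc_nb (0, 0) n (0, 0)) sums
           (4 / (pi * s) * integral {0..pi} (\<lambda>t. 1 / hphc_denom s (cos t)))"
    by (simp add: sums_def)
qed

lemma hphc_generating_function_asymp:
  "((\<lambda>x. (\<Sum>n. exp (- 1 / x) ^ n * chain_prob hphc_trans hphc_nb (0, 0) n (0, 0)) / ln x)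
     \<longlongrightarrow> 2 / pi) at_top"
proof -
  define e where "e x = exp (1 / x) - 1" for x :: real
  define U where "U x = (\<Sum>n. exp (- 1 / x) ^ n * chain_prob hphc_trans hphc_nb (0, 0) n (0, 0))"
    for x :: real
  have bounds: "4 / pi * (1 + e x) * (ln ((pi + 8 * sqrt (e x)) / (8 * sqrt (e x))) - pi) \<le> U x \<and>
       U x \<le> 4 / pi * (1 + e x) * (ln ((pi + sqrt (e x)) / sqrt (e x)) + pi)" if x: "x \<ge> 2" for x
  proof -
    define s where "s = exp (- 1 / x)"
    have s: "0 < s" "s < 1" and s': "1 / s = 1 + e x"
      using x by (auto simp: s_def e_def exp_minus field_simps)
    \<comment> \<open>Since exp (1/2) <= 7/4, the range x >= 2 ensures \<open>e x \<le> 1\<close>,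
      as the denominator bounds require.\<close>
    have "exp (1 / x) \<le> exp (1 / 2)" using x by (simp add: field_simps)
    also have "exp (1 / 2 :: real) \<le> 1 + 1 / 2 + (1 / 2)\<^sup>2" by (rule exp_bound) auto
    finally have e: "0 < e x" "e x \<le> 1" using x by (auto simp: e_def power2_eq_square)
    note gf = hphc_generating_function[OF s]
    let ?J = "integral {0..pi} (\<lambda>t. 1 / hphc_denom s (cos t))"
    have U: "U x = 4 / pi * (1 + e x) * ?J"
    proof -
      have "U x = 4 / (pi * s) * ?J"
        unfolding U_def s_def[symmetric] using gf(1) by (simp add: sums_iff)
      also have "4 / (pi * s) = 4 / pi * (1 / s)" by simp
      finally show ?thesis unfolding s' .
    qed
    have J: "((\<lambda>t. 1 / hphc_denom s (cos t)) has_integral ?J) {0..pi}"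
      using gf(2) by (rule integrable_integral)
    have "ln ((pi + 8 * sqrt (e x)) / (8 * sqrt (e x))) + (-1) * pi \<le> ?J"
      using inverse_hphc_denom_bounds(1)[OF e _ _ s'] e
      by (intro has_integral_le[OF has_integral_inverse_shift J]) auto
    moreover have "?J \<le> ln ((pi + sqrt (e x)) / sqrt (e x)) + 1 * pi"
      using inverse_hphc_denom_bounds(2)[OF e _ _ s'] e
      by (intro has_integral_le[OF J has_integral_inverse_shift]) auto
    ultimately show ?thesis
      unfolding U using e by (intro conjI mult_left_mono) auto
  qed
  have "((\<lambda>x. U x / ln x) \<longlongrightarrow> 2 / pi) at_top"
  proof (rule tendsto_sandwich)
    show "((\<lambda>x. 4 / pi * (1 + e x) * (ln ((pi + 8 * sqrt (e x)) / (8 * sqrt (e x))) - pi) / ln x)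
        \<longlongrightarrow> 2 / pi) at_top"
      unfolding e_def by real_asymp
    show "((\<lambda>x. 4 / pi * (1 + e x) * (ln ((pi + sqrt (e x)) / sqrt (e x)) + pi) / ln x)
        \<longlongrightarrow> 2 / pi) at_top"
      unfolding e_def by real_asymp
    show "\<forall>\<^sub>F x in at_top. 4 / pi * (1 + e x) * (ln ((pi + 8 * sqrt (e x)) / (8 * sqrt (e x))) - pi) / ln x
        \<le> U x / ln x"
      using eventually_ge_at_top[of 2]
      by eventually_elim (intro divide_right_mono bounds[THEN conjunct1] bounds[THEN conjunct2]; simp)
    show "\<forall>\<^sub>F x in at_top. U x / ln x
        \<le> 4 / pi * (1 + e x) * (ln ((pi + sqrt (e x)) / sqrt (e x)) + pi) / ln x"
      using eventually_ge_at_top[of 2]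
      by eventually_elim (intro divide_right_mono bounds[THEN conjunct1] bounds[THEN conjunct2]; simp)
  qed
  then show ?thesis unfolding U_def .
qed

lemma hphc_finite_range_chain:
  assumes "hphc_walk M C"
  shows "finite_range_chain M C hphc_trans hphc_nb (0, 0)"
proof
  show "markov_chain M hphc_trans C" "AE w in M. C 0 w = (0, 0)"
    using assms by (simp_all add: hphc_walk_def)
  fix x y :: "int \<times> int"
  show "finite (hphc_nb x)" by (simp add: hphc_nb_def)
  show "0 \<le> hphc_trans x y" by (cases x; cases y) (simp add: hphc_p_def)
  show "(\<Sum>y\<in>hphc_nb x. hphc_trans x y) = 1"
    using sum_hphc_nb[of "fst x" "snd x" "\<lambda>_. 1"] by (simp add: algebra_simps)
qed

theorem corollary4p3:
  fixes M :: "'w measure" and C :: "nat \<Rightarrow> 'w \<Rightarrow> int \<times> int"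
  assumes "hphc_walk M C"
  shows "AE w in M.
    limsup (\<lambda>N. ereal (real (local_time C (0, 0) N w)
                        / (ln (real N) * ln (ln (ln (real N)))))) = ereal (2 / pi)"
  using hphc_finite_range_chain[OF assms] hphc_generating_function_asymp
  by (intro finite_range_chain.local_time_iterated_logarithm) auto

end
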